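(* Let $(X,\mathcal{A})$ be a flat Lie C*-system, with action $\delta$ and pseudo-resolvents $R(\lambda,f)$, $\lambda\in\mathbb{R}\setminus\{0\}$, $f\in X$. Then there is an antisymmetric bilinear form $\sigma:X\times X\to\mathbb{R}$ such that for all $\lambda,\mu\in\mathbb{R}\setminus\{0\}$ and $f,g\in X$: (i) $[R(\lambda,f),R(\mu,g)]=i\sigma(f,g)\,R(\lambda,f)\,R(\mu,g)^2\,R(\lambda,f)$; (ii) $\delta_f(R(\mu,g))=\sigma(f,g)\,R(\mu,g)^2$. If $\delta$ acts ergodically, then $\sigma$ is non-degenerate, i.e. $(X,\sigma)$ is a symplectic space.
   Context: A pseudo-resolvent in a C*-algebra $\mathcal{A}$ is a function $R:\mathbb{R}\setminus\{0\}\to\mathcal{A}$ with $R(\lambda)-R(\mu)=i(\mu-\lambda)R(\lambda)R(\mu)$ and $R(\lambda)^*=R(-\lambda)$ for all $\lambda,\mu\in\mathbb{R}\setminus\{0\}$. It can be analytically continued to a function $z\mapsto R(z)$ on $\mathbb{C}\setminus i\mathbb{R}$. A flat Lie C*-system $(X,\mathcal{A})$ consists of the following data. $X$ is a real abelian Lie algebra of finite or infinite dimension (a real vector space with zero bracket). $\mathcal{A}$ is a unital C*-algebra which is primitive (it has a faithful irreducible representation). $\mathcal{A}_0\subset\mathcal{A}$ is a norm dense unital *-subalgebra. $\delta:X\to\mathrm{Der}\,\mathcal{A}_0$, $f\mapsto\delta_f$, is an injective real linear map into the *-derivations of $\mathcal{A}_0$ (linear maps $\mathcal{A}_0\to\mathcal{A}_0$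 satisfying the Leibniz rule and commuting with $*$) with $\delta_f\circ\delta_g=\delta_g\circ\delta_f$ for all $f,g\in X$. Finally, for each $f\in X$ there is given a pseudo-resolvent $R(\lambda,f)\in\mathcal{A}$, $\lambda\in\mathbb{R}\setminus\{0\}$, such that $R(\lambda,f)\,\delta_f(A_0)\,R(\lambda,f)=i[A_0,R(\lambda,f)]$ for all $A_0\in\mathcal{A}_0$, and whose analytic continuation satisfies $R(z,f)\in\mathcal{A}_0$ for all $z\in\mathbb{C}\setminus i\mathbb{R}$. The action $\delta$ is ergodic if, for $A_0\in\mathcal{A}_0$, $\delta_f(A_0)=0$ for all $f\in X$ implies that $A_0$ is a multiple of the identity.
   Formalization: Non-degeneracy under ergodicity is proved assuming also that for each f ≠ 0 the pseudo-resolvent R(·,f) is not identically zero; otherwise it fails (all R = 0 for X = R^3 acting on a simple noncommutative 3-torus). *)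

theory Defs
  imports "HOL-Analysis.Analysis"
begin

section \<open>Complex Hilbert spaces and unital C*-algebras\<close>

class complex_vector = real_vector +
  fixes scaleC :: "complex \<Rightarrow> 'a \<Rightarrow> 'a"  (infixr "*\<^sub>C" 75)
  assumes scaleC_add_right: "c *\<^sub>C (x + y) = c *\<^sub>C x + c *\<^sub>C y"
    and scaleC_add_left: "(c + d) *\<^sub>C x = c *\<^sub>C x + d *\<^sub>C x"
    and scaleC_scaleC: "c *\<^sub>C d *\<^sub>C x = (c * d) *\<^sub>C x"
    and scaleC_of_real: "of_real r *\<^sub>C x = r *\<^sub>R x"

text \<open>The inner product is linear in the second argument. Positive definiteness is part of
  \<open>norm_sq_cinner\<close>; completeness comes from \<^class>\<open>banach\<close>.\<close>

class chilbert_space = complex_vector + banach +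
  fixes cinner :: "'a \<Rightarrow> 'a \<Rightarrow> complex"
  assumes cinner_commute: "cinner x y = cnj (cinner y x)"
    and cinner_add_right: "cinner x (y + z) = cinner x y + cinner x z"
    and cinner_scaleC_right: "cinner x (c *\<^sub>C y) = c * cinner x y"
    and norm_sq_cinner: "of_real ((norm x)\<^sup>2) = cinner x x"

text \<open>Unital C*-algebras with \<open>1 \<noteq> 0\<close> (implied by primitivity below).\<close>

class cstar_algebra = complex_vector + real_normed_algebra_1 + banach +
  fixes star :: "'a \<Rightarrow> 'a"
  assumes mult_scaleC_left: "(c *\<^sub>C x) * y = c *\<^sub>C (x * y)"
    and mult_scaleC_right: "x * (c *\<^sub>C y) = c *\<^sub>C (x * y)"
    and norm_scaleC: "norm (c *\<^sub>C x) = cmod c * norm x"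
    and star_star: "star (star x) = x"
    and star_add: "star (x + y) = star x + star y"
    and star_scaleC: "star (c *\<^sub>C x) = cnj c *\<^sub>C star x"
    and star_mult: "star (x * y) = star y * star x"
    and cstar_identity: "norm (star x * x) = (norm x)\<^sup>2"

definition csubspace :: "'a::complex_vector set \<Rightarrow> bool" where
  "csubspace S \<longleftrightarrow>
     0 \<in> S \<and> (\<forall>x\<in>S. \<forall>y\<in>S. x + y \<in> S) \<and> (\<forall>c. \<forall>x\<in>S. c *\<^sub>C x \<in> S)"

definition commutator :: "'a::ring \<Rightarrow> 'a \<Rightarrow> 'a" where
  "commutator a b = a * b - b * a"


section \<open>Primitive C*-algebras\<close>

definition star_representation :: "('a::cstar_algebra \<Rightarrow> 'h::chilbert_space \<Rightarrow> 'h) \<Rightarrow> bool" where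
  "star_representation \<pi> \<longleftrightarrow>
     (\<forall>a. bounded_linear (\<pi> a) \<and> (\<forall>c x. \<pi> a (c *\<^sub>C x) = c *\<^sub>C \<pi> a x)) \<and>
     (\<forall>a b x. \<pi> (a + b) x = \<pi> a x + \<pi> b x) \<and>
     (\<forall>c a x. \<pi> (c *\<^sub>C a) x = c *\<^sub>C \<pi> a x) \<and>
     (\<forall>a b x. \<pi> (a * b) x = \<pi> a (\<pi> b x)) \<and>
     (\<forall>x. \<pi> 1 x = x) \<and>
     (\<forall>a x y. cinner (\<pi> (star a) x) y = cinner x (\<pi> a y))"

definition irreducible_rep :: "('a::cstar_algebra \<Rightarrow> 'h::chilbert_space \<Rightarrow> 'h) \<Rightarrow> bool" where
  "irreducible_rep \<pi> \<longleftrightarrow>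
     (\<exists>x::'h. x \<noteq> 0) \<and>
     (\<forall>S. csubspace S \<and> closed S \<and> (\<forall>a. \<forall>x\<in>S. \<pi> a x \<in> S) \<longrightarrow> S = {0} \<or> S = UNIV)"

text \<open>HOL cannot quantify over types inside a formula, so the type \<open>'h\<close> of the representation
  space is a parameter. When this predicate is a hypothesis of a theorem with \<open>'h\<close> free, the
  hypothesis amounts to the existence of a faithful irreducible representation on some
  Hilbert space.\<close>

definition primitive_on :: "'h::chilbert_space itself \<Rightarrow> 'a::cstar_algebra itself \<Rightarrow> bool" where
  "primitive_on _ _ \<longleftrightarrow>
     (\<exists>\<pi> :: 'a \<Rightarrow> 'h \<Rightarrow> 'h. star_representation \<pi> \<and> irreducible_rep \<pi> \<and> inj \<pi>)"


section \<open>Pseudo-resolvents\<close>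

text \<open>The value at \<open>0\<close> is junk: only \<open>R \<kappa>\<close> with \<open>\<kappa> \<noteq> 0\<close> is ever constrained or used.\<close>

definition pseudo_resolvent :: "(real \<Rightarrow> 'a::cstar_algebra) \<Rightarrow> bool" where
  "pseudo_resolvent R \<longleftrightarrow>
     (\<forall>\<kappa> \<mu>. \<kappa> \<noteq> 0 \<and> \<mu> \<noteq> 0 \<longrightarrow>
        R \<kappa> - R \<mu> = (\<i> * of_real (\<mu> - \<kappa>)) *\<^sub>C (R \<kappa> * R \<mu>)) \<and>
     (\<forall>\<kappa>. \<kappa> \<noteq> 0 \<longrightarrow> star (R \<kappa>) = R (- \<kappa>))"

definition cholomorphic_on :: "(complex \<Rightarrow> 'a::cstar_algebra) \<Rightarrow> complex set \<Rightarrow> bool" where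
  "cholomorphic_on F S \<longleftrightarrow> (\<forall>z\<in>S. \<exists>d. (F has_derivative (\<lambda>h. h *\<^sub>C d)) (at z within S))"

text \<open>\<open>{z. Re z \<noteq> 0}\<close> is the complement of the imaginary axis. Each of its two components
  contains a half-line on which \<open>F\<close> is prescribed, so there is at most one such \<open>F\<close> up to its
  values on the imaginary axis.\<close>

definition analytic_continuation :: "(complex \<Rightarrow> 'a::cstar_algebra) \<Rightarrow> (real \<Rightarrow> 'a) \<Rightarrow> bool" where
  "analytic_continuation F R \<longleftrightarrow>
     cholomorphic_on F {z. Re z \<noteq> 0} \<and> (\<forall>\<kappa>. \<kappa> \<noteq> 0 \<longrightarrow> F (of_real \<kappa>) = R \<kappa>)"


section \<open>Flat Lie C*-systems\<close>

definition unital_star_subalgebra :: "'a::cstar_algebra set \<Rightarrow> bool" where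
  "unital_star_subalgebra A0 \<longleftrightarrow>
     csubspace A0 \<and> 1 \<in> A0 \<and> (\<forall>a\<in>A0. \<forall>b\<in>A0. a * b \<in> A0) \<and> (\<forall>a\<in>A0. star a \<in> A0)"

definition star_derivation_on :: "'a::cstar_algebra set \<Rightarrow> ('a \<Rightarrow> 'a) \<Rightarrow> bool" where
  "star_derivation_on A0 d \<longleftrightarrow>
     (\<forall>a\<in>A0. d a \<in> A0) \<and>
     (\<forall>a\<in>A0. \<forall>b\<in>A0. d (a + b) = d a + d b) \<and>
     (\<forall>c. \<forall>a\<in>A0. d (c *\<^sub>C a) = c *\<^sub>C d a) \<and>
     (\<forall>a\<in>A0. \<forall>b\<in>A0. d (a * b) = d a * b + a * d b) \<and>
     (\<forall>a\<in>A0. d (star a) = star (d a))"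

text \<open>The abelian Lie algebra \<open>X\<close> is the real vector space \<open>'x\<close> with zero bracket. Each \<open>\<delta> f\<close> is
  a total function whose values outside \<open>A0\<close> are irrelevant; accordingly, injectivity of
  \<open>\<delta>\<close> compares restrictions to \<open>A0\<close>.\<close>

locale flat_lie_cstar_system =
  fixes H :: "'h::chilbert_space itself"
    and A0 :: "'a::cstar_algebra set"
    and \<delta> :: "'x::real_vector \<Rightarrow> 'a \<Rightarrow> 'a"
    and R :: "real \<Rightarrow> 'x \<Rightarrow> 'a"
  assumes primitive: "primitive_on H TYPE('a)"
    and subalgebra: "unital_star_subalgebra A0"
    and dense: "closure A0 = UNIV"
    and derivation: "star_derivation_on A0 (\<delta> f)"
    and linear_action: "a \<in> A0 \<Longrightarrow> linear (\<lambda>f. \<delta> f a)"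
    and injective_action: "(\<And>a. a \<in> A0 \<Longrightarrow> \<delta> f a = \<delta> g a) \<Longrightarrow> f = g"
    and commuting_action: "a \<in> A0 \<Longrightarrow> \<delta> f (\<delta> g a) = \<delta> g (\<delta> f a)"
    and resolvent: "pseudo_resolvent (\<lambda>\<kappa>. R \<kappa> f)"
    and resolvent_derivation:
      "\<kappa> \<noteq> 0 \<Longrightarrow> a \<in> A0 \<Longrightarrow> R \<kappa> f * \<delta> f a * R \<kappa> f = \<i> *\<^sub>C commutator a (R \<kappa> f)"
    and continuation_in_A0:
      "\<exists>F. analytic_continuation F (\<lambda>\<kappa>. R \<kappa> f) \<and> (\<forall>z. Re z \<noteq> 0 \<longrightarrow> F z \<in> A0)"

definition ergodic_action ::
    "'a::cstar_algebra set \<Rightarrow> ('x::real_vector \<Rightarrow> 'a \<Rightarrow> 'a) \<Rightarrow> bool" where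
  "ergodic_action A0 \<delta> \<longleftrightarrow> (\<forall>a\<in>A0. (\<forall>f. \<delta> f a = 0) \<longrightarrow> (\<exists>c. a = c *\<^sub>C 1))"

text \<open>The zero function is a pseudo-resolvent, and it satisfies all the conditions on \<open>R\<close> in
  \<open>flat_lie_cstar_system\<close> trivially. If all pseudo-resolvents vanish, ergodicity does not yield a
  non-degenerate form: let \<open>X\<close> be three-dimensional, acting by the canonical derivations on the
  smooth elements of a simple noncommutative 3-torus. The condition below excludes this.\<close>

definition nonzero_resolvents :: "(real \<Rightarrow> 'x::real_vector \<Rightarrow> 'a::cstar_algebra) \<Rightarrow> bool" where
  "nonzero_resolvents R \<longleftrightarrow> (\<forall>f. f \<noteq> 0 \<longrightarrow> (\<exists>\<kappa>. \<kappa> \<noteq> 0 \<and> R \<kappa> f \<noteq> 0))"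

definition antisymmetric :: "('x \<Rightarrow> 'x \<Rightarrow> real) \<Rightarrow> bool" where
  "antisymmetric \<sigma> \<longleftrightarrow> (\<forall>f g. \<sigma> f g = - \<sigma> g f)"

definition nondegenerate :: "('x::real_vector \<Rightarrow> 'x \<Rightarrow> real) \<Rightarrow> bool" where
  "nondegenerate \<sigma> \<longleftrightarrow> (\<forall>f. (\<forall>g. \<sigma> f g = 0) \<longrightarrow> f = 0)"

end

theory Submission
  imports Defs
begin

text \<open>Let \<open>r = R \<mu> g \<noteq> 0\<close> and \<open>D = \<delta> f r\<close>. In a primitive algebra a nonzero resolvent can be
  cancelled from either side, because its annihilators are two-sided ideals. Applying \<open>\<delta> f\<close> to
  \<open>r * \<delta> g a * r = \<i> * commutator a r\<close> and using that the derivations commute, one gets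
  \<open>D * r = r * D\<close> and then \<open>D * a * r\<^sup>2 = r\<^sup>2 * a * D\<close> for all \<open>a\<close>. So \<open>D * r\<^sup>-\<^sup>2\<close> is a closed
  operator commuting with an irreducible representation, and by Schur's lemma, applied to the
  projection onto its graph, it is a scalar \<open>\<sigma>(f, g)\<close>. Schur's lemma itself rests on a binomial
  series for \<open>sqrt (t\<^sup>2)\<close>.

  Since resolvents may vanish for some directions, \<open>\<sigma>(f, g)\<close> is determined only for those \<open>g\<close>
  with \<open>R 1 g \<noteq> 0\<close>. It is antisymmetric where both orders make sense and respects all linear
  relations among such \<open>g\<close>, hence extends to an antisymmetric bilinear form.\<close>

subsection \<open>The square root of a contraction\<close>

text \<open>The coefficient of x^n in the power series of sqrt (1 - x) at 0. The Pochhammer form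
  displays the signs.\<close>

definition sqrt_coeff :: "nat \<Rightarrow> real" where
  "sqrt_coeff n = pochhammer (- 1 / 2) n / fact n"

lemma sqrt_coeff_gchoose: "sqrt_coeff n = (- 1) ^ n * ((1 / 2) gchoose n)"
  by (simp add: sqrt_coeff_def gbinomial_pochhammer flip: mult.assoc power_mult_distrib)

lemma sqrt_coeff_0 [simp]: "sqrt_coeff 0 = 1"
  by (simp add: sqrt_coeff_def)

text \<open>Only the first factor of the Pochhammer product, -1/2, is negative.\<close>

lemma sqrt_coeff_Suc_nonpos: "sqrt_coeff (Suc n) \<le> 0"
proof -
  have "pochhammer (1 / 2 :: real) n \<ge> 0"
    by (intro less_imp_le pochhammer_pos) simp
  then show ?thesis
    by (simp add: sqrt_coeff_def pochhammer_rec divide_le_0_iff)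
qed

text \<open>The partial sums are the coefficients of sqrt (1 - x) / (1 - x) = (1 - x)^(-1/2), all of
  which are positive.\<close>

lemma sum_sqrt_coeff_nonneg: "(\<Sum>k\<le>n. sqrt_coeff k) \<ge> 0"
proof -
  have "(\<Sum>k\<le>n. sqrt_coeff k) = (- 1) ^ n * ((1 / 2 - 1) gchoose n)"
    using gbinomial_sum_lower_neg[of "1/2 :: real" n] by (simp add: sqrt_coeff_gchoose mult.commute)
  also have "\<dots> = pochhammer (1 / 2) n / fact n"
    by (simp add: gbinomial_pochhammer flip: mult.assoc power_mult_distrib)
  also have "\<dots> \<ge> 0"
    by (intro divide_nonneg_nonneg less_imp_le[OF pochhammer_pos]) auto
  finally show ?thesis .
qed

text \<open>Only the coefficient 1 at index 0 is positive, so taking absolute values turns a partial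
  sum s into 2 - s, which is at most 2. Hence the series converges at radius 1, as contractions
  require.\<close>

lemma summable_abs_sqrt_coeff: "summable (\<lambda>n. \<bar>sqrt_coeff n\<bar>)"
proof (rule summableI_nonneg_bounded)
  fix n
  have "(\<Sum>i<n. \<bar>sqrt_coeff i\<bar>) \<le> (\<Sum>i\<le>n. \<bar>sqrt_coeff i\<bar>)"
    by (intro sum_mono2) auto
  also have "\<dots> = 2 - (\<Sum>i\<le>n. sqrt_coeff i)"
    by (simp add: sum.atMost_shift abs_of_nonpos sqrt_coeff_Suc_nonpos sum_negf)
  also have "\<dots> \<le> 2"
    using sum_sqrt_coeff_nonneg[of n] by simp
  finally show "(\<Sum>i<n. \<bar>sqrt_coeff i\<bar>) \<le> 2" .
qed simp

lemma summable_sqrt_coeff: "summable sqrt_coeff"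
  using summable_abs_sqrt_coeff by (rule summable_rabs_cancel)

lemma suminf_sqrt_coeff_nonneg: "suminf sqrt_coeff \<ge> 0"
proof (rule LIMSEQ_le_const)
  show "(\<lambda>n. \<Sum>k\<le>n. sqrt_coeff k) \<longlonglongrightarrow> suminf sqrt_coeff"
    by (rule summable_LIMSEQ'[OF summable_sqrt_coeff])
qed (use sum_sqrt_coeff_nonneg in blast)

text \<open>The square of the series is 1 - x, by Vandermonde's identity for 1/2 + 1/2 = 1.\<close>

lemma sqrt_coeff_convolution:
  "(\<Sum>k\<le>n. sqrt_coeff k * sqrt_coeff (n - k)) = (if n = 0 then 1 else if n = 1 then - 1 else 0)"
proof -
  have "(\<Sum>k\<le>n. sqrt_coeff k * sqrt_coeff (n - k))
      = (\<Sum>k\<le>n. (- 1) ^ n * (((1 / 2) gchoose k) * ((1 / 2) gchoose (n - k))))"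
  proof (rule sum.cong)
    fix k assume "k \<in> {..n}"
    then have "(- 1 :: real) ^ k * (- 1) ^ (n - k) = (- 1) ^ n"
      by (simp flip: power_add)
    then show "sqrt_coeff k * sqrt_coeff (n - k)
        = (- 1) ^ n * (((1 / 2) gchoose k) * ((1 / 2) gchoose (n - k)))"
      unfolding sqrt_coeff_gchoose by simp
  qed simp
  also have "\<dots> = (- 1) ^ n * (1 gchoose n :: real)"
    using gbinomial_Vandermonde[of "1/2 :: real" "1/2" n]
    by (simp flip: sum_distrib_left add: atMost_atLeast0)
  also have "(1 gchoose n :: real) = of_nat (1 choose n)"
    using binomial_gbinomial[of 1 n, where 'a = real] by simp
  finally show ?thesis
    by (cases "n = 0"; cases "n = 1") auto
qed

text \<open>For a contraction \<open>X\<close> this is the operator \<open>sqrt (1 - X)\<close>.\<close>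

definition sqrt_op :: "('v::banach \<Rightarrow> 'v) \<Rightarrow> 'v \<Rightarrow> 'v" where
  "sqrt_op X v = (\<Sum>n. sqrt_coeff n *\<^sub>R (X ^^ n) v)"

locale linear_contraction =
  fixes X :: "'v::banach \<Rightarrow> 'v"
  assumes bounded_linear: "bounded_linear X"
    and contraction: "norm (X v) \<le> norm v"
begin

lemma norm_funpow: "norm ((X ^^ n) v) \<le> norm v"
  by (induction n) (auto intro: order_trans[OF contraction])

lemma bounded_linear_funpow: "bounded_linear (X ^^ n)"
  by (induction n)
     (auto simp: id_def comp_def intro: bounded_linear_compose[OF bounded_linear] bounded_linear_ident)

lemma summable_norm_sqrt_op: "summable (\<lambda>n. norm (sqrt_coeff n *\<^sub>R (X ^^ n) v))"
proof (rule summable_comparison_test)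
  show "\<exists>N. \<forall>n\<ge>N. norm (norm (sqrt_coeff n *\<^sub>R (X ^^ n) v)) \<le> \<bar>sqrt_coeff n\<bar> * norm v"
    by (simp add: mult_left_mono norm_funpow)
  show "summable (\<lambda>n. \<bar>sqrt_coeff n\<bar> * norm v)"
    by (intro summable_mult2 summable_abs_sqrt_coeff)
qed

lemma summable_sqrt_op: "summable (\<lambda>n. sqrt_coeff n *\<^sub>R (X ^^ n) v)"
  by (rule summable_norm_cancel[OF summable_norm_sqrt_op])

lemma bounded_linear_sqrt_op: "bounded_linear (sqrt_op X)"
proof (rule bounded_linear_intro)
  interpret P: bounded_linear "X ^^ n" for n by (rule bounded_linear_funpow)
  fix v w :: 'v and r :: real
  show "sqrt_op X (v + w) = sqrt_op X v + sqrt_op X w"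
    unfolding sqrt_op_def
    by (subst suminf_add[OF summable_sqrt_op summable_sqrt_op])
       (simp add: P.add scaleR_add_right)
  show "sqrt_op X (r *\<^sub>R v) = r *\<^sub>R sqrt_op X v"
    unfolding sqrt_op_def
    by (simp add: P.scaleR mult.commute suminf_scaleR_right[OF summable_sqrt_op])
  show "norm (sqrt_op X v) \<le> norm v * (\<Sum>n. \<bar>sqrt_coeff n\<bar>)"
    unfolding sqrt_op_def
    by (subst suminf_mult[OF summable_abs_sqrt_coeff, symmetric])
       (intro norm_suminf_le summable_mult summable_abs_sqrt_coeff,
        simp add: mult.commute[of "norm v"] mult_left_mono norm_funpow)
qed

text \<open>Serves to show that the square root inherits the commutation properties of
  \<open>X\<close>: with complex scalars, with the representation and with the operator whose square
  defines \<open>X\<close>.\<close>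

lemma sqrt_op_commute:
  assumes T: "bounded_linear T" and "\<And>v. T (X v) = X (T v)"
  shows "T (sqrt_op X v) = sqrt_op X (T v)"
proof -
  interpret T: bounded_linear T by fact
  have *: "T ((X ^^ n) v) = (X ^^ n) (T v)" for n
    by (induction n) (auto simp: assms)
  show ?thesis
    unfolding sqrt_op_def by (subst T.suminf[OF summable_sqrt_op]) (simp add: T.scaleR *)
qed

text \<open>A Cauchy product of operator series. Sums over squares of indices are compared with sums
  over triangles; the triangles give \<open>v - X v\<close> exactly, and the remainder is dominated
  by that of the scalar series of absolute values.\<close>

lemma sqrt_op_sqrt_op: "sqrt_op X (sqrt_op X v) = v - X v"
proof -
  interpret P: bounded_linear "X ^^ n" for n by (rule bounded_linear_funpow)
  let ?c = sqrt_coeff and ?S1 = "\<lambda>n::nat. {..<n} \<times> {..<n}" and ?S2 = "\<lambda>n::nat. {(i,j). i + j < n}"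
  define S where "S N w = (\<Sum>n<N. ?c n *\<^sub>R (X ^^ n) w)" for N w
  define M where "M = (\<Sum>n. \<bar>?c n\<bar>)"
  let ?g = "\<lambda>(i,j). (?c i * ?c j) *\<^sub>R (X ^^ (i + j)) v"
  let ?h = "\<lambda>(i,j). \<bar>?c i\<bar> * \<bar>?c j\<bar>"
  have S_lim: "(\<lambda>N. S N w) \<longlonglongrightarrow> sqrt_op X w" for w
    unfolding S_def sqrt_op_def by (rule summable_LIMSEQ[OF summable_sqrt_op])
  have S_norm: "norm (S N w) \<le> M * norm w" for N w
  proof -
    have "norm (S N w) \<le> (\<Sum>n<N. \<bar>?c n\<bar> * norm w)"
      unfolding S_def by (intro sum_norm_le) (simp add: mult_left_mono norm_funpow)
    also have "\<dots> \<le> M * norm w"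
      unfolding M_def sum_distrib_right[symmetric]
      by (intro mult_right_mono sum_le_suminf summable_abs_sqrt_coeff) auto
    finally show ?thesis .
  qed
  have S_diff: "S N (a - b) = S N a - S N b" for N a b
    by (simp add: S_def P.diff scaleR_diff_right sum_subtractf)
  \<comment> \<open>Both partial sums grow together; the bound \<open>M\<close>, uniform in
    \<open>N\<close>, allows the inner one to be replaced by its limit.\<close>
  have "(\<lambda>N. S N (S N v - sqrt_op X v)) \<longlonglongrightarrow> 0"
  proof (rule Lim_null_comparison)
    show "\<forall>\<^sub>F N in sequentially. norm (S N (S N v - sqrt_op X v)) \<le> M * norm (S N v - sqrt_op X v)"
      by (simp add: S_norm)
    show "(\<lambda>N. M * norm (S N v - sqrt_op X v)) \<longlonglongrightarrow> 0"
      using S_lim[of v] by (intro tendsto_mult_right_zero tendsto_norm_zero) (simp add: LIM_zero_iff)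
  qed
  from tendsto_add[OF this S_lim[of "sqrt_op X v"]]
  have SS: "(\<lambda>N. S N (S N v)) \<longlonglongrightarrow> sqrt_op X (sqrt_op X v)"
    by (simp add: S_diff)
  have SS_eq: "S N (S N v) = sum ?g (?S1 N)" for N
  proof -
    have "S N (S N v) = (\<Sum>i<N. \<Sum>j<N. (?c i * ?c j) *\<^sub>R (X ^^ (i + j)) v)"
      by (simp add: S_def P.sum P.scaleR scaleR_sum_right funpow_add)
    then show ?thesis by (simp add: sum.cartesian_product)
  qed
  \<comment> \<open>The convolution vanishes from index 2 on, and for \<open>N \<ge> 2\<close> the
    triangle contains both surviving diagonals.\<close>
  have S2_eq: "sum ?g (?S2 N) = v - X v" if "N \<ge> 2" for N
  proof -
    have "sum ?g (?S2 N) = (\<Sum>n<N. \<Sum>i\<le>n. (?c i * ?c (n - i)) *\<^sub>R (X ^^ (i + (n - i))) v)"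
      by (rule sum.triangle_reindex)
    also have "\<dots> = (\<Sum>n<N. (\<Sum>i\<le>n. ?c i * ?c (n - i)) *\<^sub>R (X ^^ n) v)"
      by (simp add: scaleR_sum_left)
    also have "\<dots> = (\<Sum>n\<in>{0,1}. (\<Sum>i\<le>n. ?c i * ?c (n - i)) *\<^sub>R (X ^^ n) v)"
      using that by (intro sum.mono_neutral_right) (auto simp: sqrt_coeff_convolution)
    also have "\<dots> = v - X v"
      by (simp only: sqrt_coeff_convolution) simp
    finally show ?thesis .
  qed
  have sub: "?S2 N \<subseteq> ?S1 N" for N by auto
  then have fin: "finite (?S2 N)" for N by (rule finite_subset) simp
  \<comment> \<open>By absolute convergence, squares and triangles of the scalar series have the
    same limit.\<close>
  have "(\<lambda>N. sum ?h (?S1 N) - sum ?h (?S2 N)) \<longlonglongrightarrow> M * M - M * M"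
  proof (rule tendsto_diff)
    have "(\<lambda>N. (\<Sum>n<N. \<bar>?c n\<bar>) * (\<Sum>n<N. \<bar>?c n\<bar>)) \<longlonglongrightarrow> M * M"
      unfolding M_def by (intro tendsto_mult summable_LIMSEQ summable_abs_sqrt_coeff)
    then show "(\<lambda>N. sum ?h (?S1 N)) \<longlonglongrightarrow> M * M"
      by (simp only: sum_product sum.cartesian_product)
    show "(\<lambda>N. sum ?h (?S2 N)) \<longlonglongrightarrow> M * M"
      using Cauchy_product_sums[of "\<lambda>n. \<bar>?c n\<bar>" "\<lambda>n. \<bar>?c n\<bar>"] summable_abs_sqrt_coeff
      by (simp add: sums_def sum.triangle_reindex M_def)
  qed
  then have lim: "(\<lambda>N. (sum ?h (?S1 N) - sum ?h (?S2 N)) * norm v) \<longlonglongrightarrow> 0"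
    by (intro tendsto_mult_left_zero) simp
  have le: "norm (sum ?g (?S1 N) - sum ?g (?S2 N))
      \<le> (sum ?h (?S1 N) - sum ?h (?S2 N)) * norm v" for N
  proof -
    have "norm (sum ?g (?S1 N - ?S2 N)) \<le> (\<Sum>p\<in>?S1 N - ?S2 N. ?h p * norm v)"
      by (rule sum_norm_le) (auto simp: abs_mult intro!: mult_left_mono norm_funpow)
    then show ?thesis
      by (simp add: sum_diff[OF _ sub] sum_distrib_right[symmetric])
  qed
  have "(\<lambda>N. S N (S N v) - (v - X v)) \<longlonglongrightarrow> 0"
  proof (rule Lim_null_comparison[OF _ lim])
    show "\<forall>\<^sub>F N in sequentially.
        norm (S N (S N v) - (v - X v)) \<le> (sum ?h (?S1 N) - sum ?h (?S2 N)) * norm v"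
      using eventually_ge_at_top[of 2]
    proof eventually_elim
      fix N :: nat assume "N \<ge> 2"
      from le[of N] show "norm (S N (S N v) - (v - X v)) \<le> (sum ?h (?S1 N) - sum ?h (?S2 N)) * norm v"
        by (simp only: SS_eq S2_eq[OF \<open>N \<ge> 2\<close>])
    qed
  qed
  then have "(\<lambda>N. S N (S N v)) \<longlonglongrightarrow> v - X v"
    by (simp add: LIM_zero_iff)
  with SS show ?thesis by (rule LIMSEQ_unique)
qed

end

subsection \<open>The real inner product of a complex Hilbert space\<close>

text \<open>Real-valued, so that the locale \<open>banach_inner\<close> below covers both the
  Hilbert space and its double, which is treated as a real Banach space.\<close>

definition rinner :: "'h::chilbert_space \<Rightarrow> 'h \<Rightarrow> real" where
  "rinner x y = Re (cinner x y)"

section \<open>Arithmetic of complex scalars\<close>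

lemma scaleC_zero_left [simp]: "0 *\<^sub>C (x :: 'a::complex_vector) = 0"
  using scaleC_of_real[of 0 x] by simp

lemma scaleC_one [simp]: "1 *\<^sub>C (x :: 'a::complex_vector) = x"
  using scaleC_of_real[of 1 x] by simp

lemma scaleC_minus1: "(- 1) *\<^sub>C (x :: 'a::complex_vector) = - x"
  using scaleC_of_real[of "-1" x] by simp

lemma scaleC_zero_right [simp]: "c *\<^sub>C (0 :: 'a::complex_vector) = 0"
  using scaleC_add_right[of c 0 "0 :: 'a"] by simp

lemma scaleC_minus_right: "c *\<^sub>C (- x :: 'a::complex_vector) = - (c *\<^sub>C x)"
  using scaleC_add_right[of c x "- x"] by (simp add: eq_neg_iff_add_eq_0 add.commute)

lemma scaleC_diff_right: "c *\<^sub>C (x - y :: 'a::complex_vector) = c *\<^sub>C x - c *\<^sub>C y"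
  using scaleC_add_right[of c x "- y"] by (simp add: scaleC_minus_right)

lemma scaleC_minus_left: "(- c) *\<^sub>C (x :: 'a::complex_vector) = - (c *\<^sub>C x)"
  using scaleC_scaleC[of "- 1" c x] by (simp add: scaleC_minus1)

lemma scaleC_diff_left: "(c - d) *\<^sub>C (x :: 'a::complex_vector) = c *\<^sub>C x - d *\<^sub>C x"
  using scaleC_add_left[of c "- d" x] by (simp add: scaleC_minus_left)

lemma scaleC_eq_0_iff [simp]: "c *\<^sub>C (x :: 'a::complex_vector) = 0 \<longleftrightarrow> c = 0 \<or> x = 0"
proof
  assume *: "c *\<^sub>C x = 0"
  have "(inverse c * c) *\<^sub>C x = 0"
    by (simp add: * flip: scaleC_scaleC)
  then show "c = 0 \<or> x = 0" by (cases "c = 0") auto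
qed auto

lemma scaleC_cancel_left [simp]:
  "c *\<^sub>C (x :: 'a::complex_vector) = c *\<^sub>C y \<longleftrightarrow> c = 0 \<or> x = y"
  using scaleC_eq_0_iff[of c "x - y"] by (simp add: scaleC_diff_right)

lemma scaleC_sum_right: "c *\<^sub>C (\<Sum>i\<in>I. x i :: 'a::complex_vector) = (\<Sum>i\<in>I. c *\<^sub>C x i)"
  by (induction I rule: infinite_finite_induct) (auto simp: scaleC_add_right)

lemma scaleC_scaleR: "c *\<^sub>C (r *\<^sub>R x :: 'a::complex_vector) = r *\<^sub>R (c *\<^sub>C x)"
  by (simp add: scaleC_scaleC mult.commute flip: scaleC_of_real)

lemma rinner_commute: "rinner x y = rinner y x"
  by (simp add: rinner_def cinner_commute[of x y])

lemma rinner_add_right: "rinner x (y + z) = rinner x y + rinner x z"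
  by (simp add: rinner_def cinner_add_right)

lemma rinner_scaleR_right: "rinner x (r *\<^sub>R y) = r * rinner x y"
  by (simp add: rinner_def cinner_scaleC_right flip: scaleC_of_real)

lemma rinner_scaleC: "rinner (c *\<^sub>C x) y = rinner x (cnj c *\<^sub>C y)"
  by (simp add: rinner_def cinner_scaleC_right cinner_commute[of "c *\<^sub>C x" y] cinner_commute[of x y])

lemma rinner_norm: "rinner x x = (norm x)\<^sup>2"
  using arg_cong[OF norm_sq_cinner[of x], of Re] by (simp add: rinner_def del: of_real_power)

lemma norm_scaleC_hilbert: "norm (c *\<^sub>C (x :: 'h::chilbert_space)) = cmod c * norm x"
proof (rule power2_eq_imp_eq)
  have "(norm (c *\<^sub>C x))\<^sup>2 = rinner x (of_real ((cmod c)\<^sup>2) *\<^sub>C x)"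
    by (simp only: rinner_scaleC scaleC_scaleC mult.commute[of "cnj c"] complex_norm_square
          flip: rinner_norm)
  then show "(norm (c *\<^sub>C x))\<^sup>2 = (cmod c * norm x)\<^sup>2"
    by (simp add: scaleC_of_real rinner_scaleR_right rinner_norm power_mult_distrib del: of_real_power)
qed auto

lemma bounded_linear_scaleC_hilbert: "bounded_linear (\<lambda>x :: 'h::chilbert_space. c *\<^sub>C x)"
  by (rule bounded_linear_intro[where K = "cmod c"])
     (auto simp: scaleC_add_right scaleC_scaleR norm_scaleC_hilbert)

subsection \<open>Orthogonal projections\<close>

locale banach_inner =
  fixes ip :: "'v::banach \<Rightarrow> 'v \<Rightarrow> real"
  assumes ip_commute: "ip x y = ip y x"
    and ip_add_right: "ip x (y + z) = ip x y + ip x z"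
    and ip_scaleR_right: "ip x (r *\<^sub>R y) = r * ip x y"
    and ip_norm: "ip x x = (norm x)\<^sup>2"
begin

lemma ip_add_left: "ip (x + y) z = ip x z + ip y z"
  using ip_add_right ip_commute by metis

lemma ip_scaleR_left: "ip (r *\<^sub>R x) z = r * ip x z"
  using ip_scaleR_right ip_commute by metis

lemma ip_minus_right: "ip x (- y) = - ip x y"
  using ip_scaleR_right[of x "- 1" y] by simp

lemma ip_minus_left: "ip (- x) y = - ip x y"
  using ip_scaleR_left[of "- 1" x y] by simp

lemma ip_diff_right: "ip x (y - z) = ip x y - ip x z"
  using ip_add_right[of x y "- z"] by (simp add: ip_minus_right)

lemma ip_diff_left: "ip (x - y) z = ip x z - ip y z"
  using ip_add_left[of x "- y" z] by (simp add: ip_minus_left)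

lemmas ip_simps = ip_add_left ip_add_right ip_diff_left ip_diff_right
  ip_scaleR_left ip_scaleR_right

lemma ip_cauchy_schwarz: "ip x y \<le> norm x * norm y"
proof -
  have "(norm (x + y))\<^sup>2 \<le> (norm x + norm y)\<^sup>2"
    by (intro power_mono norm_triangle_ineq) auto
  then show ?thesis
    by (simp add: ip_simps ip_commute[of y x] power2_sum flip: ip_norm)
qed

lemma bounded_linear_ip_right: "bounded_linear (ip x)"
proof (rule bounded_linear_intro[where K = "norm x"])
  show "norm (ip x y) \<le> norm y * norm x" for y
    using ip_cauchy_schwarz[of x y] ip_cauchy_schwarz[of "- x" y]
    by (simp add: ip_minus_left abs_le_iff mult.commute)
qed (simp_all add: ip_add_right ip_scaleR_right)

lemma parallelogram:
  fixes x y :: 'v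
  shows "(norm (x - y))\<^sup>2 = 2 * (norm x)\<^sup>2 + 2 * (norm y)\<^sup>2 - (norm (x + y))\<^sup>2"
  unfolding ip_norm[symmetric] by (simp add: ip_simps ip_commute[of y x])

lemma minimal_imp_orthogonal:
  assumes "\<And>e. (norm x)\<^sup>2 \<le> (norm (x - e *\<^sub>R u))\<^sup>2"
  shows "ip x u = 0"
proof (cases "u = 0")
  case True
  then show ?thesis using ip_scaleR_right[of x 0 0] by simp
next
  case False
  \<comment> \<open>The minimiser of the quadratic function
    \<open>e \<mapsto> (norm (x - e *\<^sub>R u))\<^sup>2\<close>.\<close>
  define e where "e = ip x u / (norm u)\<^sup>2"
  have "0 \<le> - 2 * (e * ip x u) + e * (e * (norm u)\<^sup>2)"
    using assms[of e] by (simp add: ip_simps ip_commute[of u x] algebra_simps flip: ip_norm)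
  also have "e * (norm u)\<^sup>2 = ip x u"
    using False by (simp add: e_def)
  finally have "(ip x u)\<^sup>2 / (norm u)\<^sup>2 \<le> 0"
    by (simp add: e_def power2_eq_square)
  then show ?thesis
    using False by (simp add: divide_le_0_iff)
qed

text \<open>A sequence minimising the distance to \<open>z\<close> is Cauchy, and its limit is a
  nearest point of \<open>S\<close>; the error at a nearest point is orthogonal to
  \<open>S\<close>.\<close>

lemma orthogonal_projection_exists:
  assumes "closed S" "subspace S"
  shows "\<exists>w\<in>S. \<forall>u\<in>S. ip (z - w) u = 0"
proof -
  define d where "d = (INF w\<in>S. (norm (z - w))\<^sup>2)"
  have ne: "S \<noteq> {}" using \<open>subspace S\<close> subspace_0 by blast
  have bdd: "bdd_below ((\<lambda>w. (norm (z - w))\<^sup>2) ` S)"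
    by (rule bdd_belowI2[of _ 0]) auto
  have d_le: "d \<le> (norm (z - w))\<^sup>2" if "w \<in> S" for w
    unfolding d_def using bdd that by (rule cINF_lower)
  have "\<exists>w\<in>S. (norm (z - w))\<^sup>2 < d + 1 / real (Suc n)" for n
  proof -
    have "d < d + 1 / real (Suc n)" by simp
    then show ?thesis
      unfolding d_def by (subst (asm) cINF_less_iff[OF ne bdd]) auto
  qed
  then obtain W where W: "\<And>n. W n \<in> S" "\<And>n. (norm (z - W n))\<^sup>2 < d + 1 / real (Suc n)"
    by metis
  \<comment> \<open>The midpoint of \<open>W m\<close> and \<open>W n\<close> lies in
    \<open>S\<close>, so its squared distance to \<open>z\<close> is at least \<open>d\<close>; the
    parallelogram identity turns this into a bound on \<open>W m - W n\<close>.\<close>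
  have close: "(norm (W m - W n))\<^sup>2 \<le> 2 / real (Suc m) + 2 / real (Suc n)" for m n
  proof -
    have "(1/2) *\<^sub>R (W m + W n) \<in> S"
      using W(1) \<open>subspace S\<close> by (intro subspace_scale subspace_add)
    from d_le[OF this] have "4 * d \<le> (norm (2 *\<^sub>R (z - (1/2) *\<^sub>R (W m + W n))))\<^sup>2"
      by (simp add: power_mult_distrib)
    also have "2 *\<^sub>R (z - (1/2) *\<^sub>R (W m + W n)) = (z - W n) + (z - W m)"
      by (simp add: scaleR_diff_right scaleR_2)
    finally have "(norm ((z - W n) - (z - W m)))\<^sup>2
        \<le> 2 * (norm (z - W n))\<^sup>2 + 2 * (norm (z - W m))\<^sup>2 - 4 * d"
      using parallelogram[of "z - W n" "z - W m"] by simp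
    also have "(z - W n) - (z - W m) = W m - W n" by simp
    finally show ?thesis using W(2)[of m] W(2)[of n] by simp
  qed
  have "Cauchy W"
  proof (rule CauchyI)
    fix e :: real assume "e > 0"
    then have "e\<^sup>2 / 4 > 0" by simp
    then obtain M where M: "1 / real (Suc M) < e\<^sup>2 / 4"
      using reals_Archimedean[of "e\<^sup>2 / 4"] by (auto simp only: inverse_eq_divide)
    show "\<exists>M. \<forall>m\<ge>M. \<forall>n\<ge>M. norm (W m - W n) < e"
    proof (intro exI allI impI)
      fix m n assume "M \<le> m" "M \<le> n"
      then have "1 / real (Suc m) \<le> 1 / real (Suc M)" "1 / real (Suc n) \<le> 1 / real (Suc M)"
        by (auto intro!: divide_left_mono)
      with M close[of m n] have "(norm (W m - W n))\<^sup>2 < e\<^sup>2" by simp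
      then show "norm (W m - W n) < e"
        by (rule power2_less_imp_less) (use \<open>e > 0\<close> in simp)
    qed
  qed
  then obtain w where lim: "W \<longlonglongrightarrow> w"
    using Cauchy_convergent convergentD by blast
  with W(1) \<open>closed S\<close> have w: "w \<in> S"
    by (meson closed_sequentially)
  have "(\<lambda>n. (norm (z - W n))\<^sup>2) \<longlonglongrightarrow> (norm (z - w))\<^sup>2"
    by (intro tendsto_intros lim)
  moreover have "(\<lambda>n. d + 1 / real (Suc n)) \<longlonglongrightarrow> d + 0"
    by (intro tendsto_add tendsto_const LIMSEQ_Suc[OF lim_1_over_n])
  ultimately have le_d: "(norm (z - w))\<^sup>2 \<le> d + 0"
    by (rule LIMSEQ_le) (use W(2) less_imp_le in blast)
  have "ip (z - w) u = 0" if "u \<in> S" for u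
  proof (rule minimal_imp_orthogonal)
    fix e
    have "w + e *\<^sub>R u \<in> S"
      using that w \<open>subspace S\<close> by (intro subspace_add subspace_scale)
    from d_le[OF this] le_d show "(norm (z - w))\<^sup>2 \<le> (norm (z - w - e *\<^sub>R u))\<^sup>2"
      unfolding diff_diff_add by linarith
  qed
  with w show ?thesis by blast
qed

end

text \<open>The projection of an arbitrary point; meaningful only for a closed subspace \<open>S\<close>.\<close>

definition proj_onto :: "('v::banach \<Rightarrow> 'v \<Rightarrow> real) \<Rightarrow> 'v set \<Rightarrow> 'v \<Rightarrow> 'v" where
  "proj_onto ip S z = (SOME w. w \<in> S \<and> (\<forall>u\<in>S. ip (z - w) u = 0))"

locale closed_subspace_of_inner = banach_inner ip for ip :: "'v::banach \<Rightarrow> 'v \<Rightarrow> real" +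
  fixes S :: "'v set"
  assumes closed: "closed S" and subspace: "subspace S"
begin

abbreviation E where "E \<equiv> proj_onto ip S"

lemma proj_in: "E z \<in> S" and proj_orth: "u \<in> S \<Longrightarrow> ip (z - E z) u = 0"
  using someI_ex[of "\<lambda>w. w \<in> S \<and> (\<forall>u\<in>S. ip (z - w) u = 0)"]
    orthogonal_projection_exists[OF closed subspace, of z]
  by (auto simp: proj_onto_def Bex_def)

lemma proj_unique:
  assumes "w \<in> S" "\<And>u. u \<in> S \<Longrightarrow> ip (z - w) u = 0"
  shows "E z = w"
proof -
  have "E z - w \<in> S" using assms proj_in subspace by (simp add: subspace_diff)
  then have "ip (z - w) (E z - w) - ip (z - E z) (E z - w) = 0"
    using assms proj_orth by simp
  then have "ip (E z - w) (E z - w) = 0"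
    by (simp add: ip_diff_left)
  then show ?thesis by (simp add: ip_norm)
qed

lemma proj_id: "z \<in> S \<Longrightarrow> E z = z"
  by (rule proj_unique) (use ip_scaleR_left[of 0] in auto)

lemma proj_selfadjoint: "ip (E x) y = ip x (E y)"
proof -
  have "ip (E x) (y - E y) = 0" "ip (x - E x) (E y) = 0"
    using proj_orth proj_in ip_commute by metis+
  then show ?thesis by (simp add: ip_diff_left ip_diff_right)
qed

text \<open>If \<open>g\<close> and its adjoint \<open>h\<close> preserve \<open>S\<close>, then
  \<open>g\<close> preserves the orthogonal complement as well, so it respects the decomposition
  defining \<open>E\<close>.\<close>

lemma proj_commute:
  assumes inv: "\<And>u. u \<in> S \<Longrightarrow> g u \<in> S" "\<And>u. u \<in> S \<Longrightarrow> h u \<in> S"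
    and adj: "\<And>x y. ip (g x) y = ip x (h y)"
    and diff: "\<And>x y. g (x - y) = g x - g y"
  shows "E (g z) = g (E z)"
proof (rule proj_unique)
  fix u assume "u \<in> S"
  then show "ip (g z - g (E z)) u = 0"
    using proj_orth inv(2) by (simp add: adj flip: diff)
qed (use proj_in inv in auto)

lemma bounded_linear_proj: "bounded_linear E"
proof (rule bounded_linear_intro)
  show "E (x + y) = E x + E y" for x y
  proof (rule proj_unique)
    show "ip (x + y - (E x + E y)) u = 0" if "u \<in> S" for u
      using proj_orth[OF that] by (simp add: ip_add_left ip_diff_left)
  qed (use proj_in subspace in \<open>auto intro: subspace_add\<close>)
  show "E (r *\<^sub>R x) = r *\<^sub>R E x" for r x
    by (rule proj_commute[where h = "\<lambda>x. r *\<^sub>R x"])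
       (use subspace in \<open>auto simp: ip_simps scaleR_diff_right intro: subspace_scale\<close>)
  show "norm (E x) \<le> norm x * 1" for x
  proof -
    have "norm (E x) * norm (E x) = ip x (E x)"
      using proj_orth[OF proj_in, of x x] by (simp add: ip_diff_left ip_norm power2_eq_square)
    also have "\<dots> \<le> norm x * norm (E x)" by (rule ip_cauchy_schwarz)
    finally show ?thesis
      by (cases "E x = 0") auto
  qed
qed

end

interpretation rinner: banach_inner rinner
proof
  show "rinner x y = rinner y x"  for x y :: "'h::chilbert_space" by (rule rinner_commute)
qed (simp_all add: rinner_add_right rinner_scaleR_right rinner_norm)

definition rinner_prod :: "'h::chilbert_space \<times> 'h \<Rightarrow> 'h \<times> 'h \<Rightarrow> real" where
  "rinner_prod p q = rinner (fst p) (fst q) + rinner (snd p) (snd q)"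

interpretation rinner_prod: banach_inner rinner_prod
proof
  show "rinner_prod p q = rinner_prod q p" for p q :: "'h::chilbert_space \<times> 'h"
    unfolding rinner_prod_def by (simp only: rinner_commute)
  show "rinner_prod p (q + r) = rinner_prod p q + rinner_prod p r" for p q r :: "'h::chilbert_space \<times> 'h"
    by (simp add: rinner_prod_def rinner_add_right)
  show "rinner_prod p (r *\<^sub>R q) = r * rinner_prod p q" for p q :: "'h::chilbert_space \<times> 'h" and r
    by (simp add: rinner_prod_def rinner_scaleR_right distrib_left)
  show "rinner_prod p p = (norm p)\<^sup>2" for p :: "'h::chilbert_space \<times> 'h"
    by (simp add: rinner_prod_def rinner_norm norm_prod_def)
qed

subsection \<open>Schur's lemma\<close>

locale irreducible_star_rep =
  fixes \<pi> :: "'a::cstar_algebra \<Rightarrow> 'h::chilbert_space \<Rightarrow> 'h"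
  assumes rep: "star_representation \<pi>"
    and irreducible: "irreducible_rep \<pi>"
begin

lemma bounded_linear_rep: "bounded_linear (\<pi> a)"
  and rep_scaleC_right: "\<pi> a (c *\<^sub>C x) = c *\<^sub>C \<pi> a x"
  and rep_scaleC_left: "\<pi> (c *\<^sub>C a) x = c *\<^sub>C \<pi> a x"
  and rep_mult: "\<pi> (a * b) x = \<pi> a (\<pi> b x)"
  and rep_1 [simp]: "\<pi> 1 x = x"
  and rep_rinner: "rinner (\<pi> (star a) x) y = rinner x (\<pi> a y)"
  using rep by (auto simp: star_representation_def rinner_def)

lemmas rep_add_right = bounded_linear.axioms(1)[OF bounded_linear_rep, THEN linear_add]
  and rep_diff_right = bounded_linear.axioms(1)[OF bounded_linear_rep, THEN linear_diff]
  and rep_0_right [simp] = bounded_linear.axioms(1)[OF bounded_linear_rep, THEN linear_0]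

lemma rep_0_left [simp]: "\<pi> 0 x = 0"
  using rep_scaleC_left[of 0 0 x] by simp

lemma invariant_subspace_trivial:
  assumes "csubspace S" "closed S" "\<And>a x. x \<in> S \<Longrightarrow> \<pi> a x \<in> S"
  shows "S = {0} \<or> S = UNIV"
  using irreducible assms unfolding irreducible_rep_def by blast

text \<open>These operators form the commutant of the representation.\<close>

definition intertwiner :: "('h \<Rightarrow> 'h) \<Rightarrow> bool" where
  "intertwiner t \<longleftrightarrow> bounded_linear t \<and> (\<forall>c x. t (c *\<^sub>C x) = c *\<^sub>C t x) \<and>
     (\<forall>a x. t (\<pi> a x) = \<pi> a (t x))"

lemma intertwinerD:
  assumes "intertwiner t"
  shows "bounded_linear t" "t (c *\<^sub>C x) = c *\<^sub>C t x" "t (\<pi> a x) = \<pi> a (t x)"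
  using assms by (auto simp: intertwiner_def)

lemma intertwiner_id: "intertwiner (\<lambda>x. x)"
  by (simp add: intertwiner_def bounded_linear_ident)

lemma intertwiner_add: "intertwiner s \<Longrightarrow> intertwiner t \<Longrightarrow> intertwiner (\<lambda>x. s x + t x)"
  by (simp add: intertwiner_def bounded_linear_add scaleC_add_right rep_add_right)

lemma intertwiner_diff: "intertwiner s \<Longrightarrow> intertwiner t \<Longrightarrow> intertwiner (\<lambda>x. s x - t x)"
  by (simp add: intertwiner_def bounded_linear_sub scaleC_diff_right rep_diff_right)

lemma intertwiner_scaleC: "intertwiner t \<Longrightarrow> intertwiner (\<lambda>x. c *\<^sub>C t x)"
  by (auto simp: intertwiner_def scaleC_scaleC mult.commute rep_scaleC_right
      intro: bounded_linear_compose[OF bounded_linear_scaleC_hilbert])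

lemma intertwiner_scaleR: "intertwiner t \<Longrightarrow> intertwiner (\<lambda>x. r *\<^sub>R t x)"
  using intertwiner_scaleC[of t "of_real r"] by (simp add: scaleC_of_real)

lemma intertwiner_compose: "intertwiner s \<Longrightarrow> intertwiner t \<Longrightarrow> intertwiner (\<lambda>x. s (t x))"
  by (auto simp: intertwiner_def intro: bounded_linear_compose)

text \<open>The kernel is a closed invariant subspace. Consequently an intertwiner that kills one
  nonzero vector is zero.\<close>

lemma intertwiner_kernel:
  assumes "intertwiner t"
  shows "{x. t x = 0} = {0} \<or> {x. t x = 0} = UNIV"
proof (rule invariant_subspace_trivial)
  interpret t: bounded_linear t by (rule intertwinerD[OF assms])
  show "csubspace {x. t x = 0}"
    by (simp add: csubspace_def t.zero t.add intertwinerD[OF assms])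
  show "closed {x. t x = 0}"
    by (intro closed_Collect_eq t.continuous_on continuous_on_id continuous_on_const)
qed (simp add: intertwinerD[OF assms])

text \<open>The operator \<open>W = sqrt (t\<^sup>2)\<close> satisfies \<open>(W + t) (W - t) = 0\<close>, and the kernel of \<open>W + t\<close> is
  an invariant subspace.\<close>

lemma selfadjoint_contraction_definite:
  assumes t: "intertwiner t" and selfadjoint: "\<And>x y. rinner (t x) y = rinner x (t y)"
    and contraction: "\<And>x. norm (t x) \<le> norm x"
  shows "(\<forall>x. 0 \<le> rinner x (t x)) \<or> (\<forall>x. rinner x (t x) \<le> 0)"
proof -
  interpret t: bounded_linear t by (rule intertwinerD[OF t])
  \<comment> \<open>Chosen so that the square root of \<open>1 - X\<close> is the absolute value of
    \<open>t\<close>. It is a contraction because \<open>t\<close> is selfadjoint and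
    contractive.\<close>
  define X where "X = (\<lambda>x. x - t (t x))"
  have X: "intertwiner X"
    unfolding X_def by (rule intertwiner_diff[OF intertwiner_id intertwiner_compose[OF t t]])
  interpret linear_contraction X
  proof (rule linear_contraction.intro)
    show "bounded_linear X" by (rule intertwinerD[OF X])
    show "norm (X v) \<le> norm v" for v
    proof (rule power2_le_imp_le)
      have "(norm (X v))\<^sup>2 = (norm v)\<^sup>2 - 2 * (norm (t v))\<^sup>2 + (norm (t (t v)))\<^sup>2"
        unfolding X_def rinner_norm[symmetric] using selfadjoint[of v "t v"]
        by (simp add: rinner.ip_simps rinner_commute[of "t (t v)" v])
      moreover have "(norm (t (t v)))\<^sup>2 \<le> (norm (t v))\<^sup>2"
        using contraction[of "t v"] by (intro power_mono) auto
      ultimately show "(norm (X v))\<^sup>2 \<le> (norm v)\<^sup>2"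
        using zero_le_power2[of "norm (t v)"] by linarith
    qed simp
  qed
  let ?W = "sqrt_op X"
  interpret W: bounded_linear ?W by (rule bounded_linear_sqrt_op)
  have "intertwiner ?W"
    unfolding intertwiner_def
  proof (intro conjI allI)
    show "?W (c *\<^sub>C x) = c *\<^sub>C ?W x" for c x
      by (rule sqrt_op_commute[symmetric, OF bounded_linear_scaleC_hilbert])
         (simp add: intertwinerD[OF X])
    show "?W (\<pi> a x) = \<pi> a (?W x)" for a x
      by (rule sqrt_op_commute[symmetric, OF bounded_linear_rep]) (simp add: intertwinerD[OF X])
  qed (rule bounded_linear_sqrt_op)
  then have "intertwiner (\<lambda>x. ?W x + t x)"
    by (intro intertwiner_add t)
  then consider "{x. ?W x + t x = 0} = {0}" | "{x. ?W x + t x = 0} = UNIV"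
    using intertwiner_kernel by blast
  then have W_cases: "(\<forall>x. t x = ?W x) \<or> (\<forall>x. t x = - ?W x)"
  proof cases
    case 1
    \<comment> \<open>\<open>W\<close> commutes with \<open>t\<close> and both have the same square,
      so \<open>W + t\<close> kills the range of \<open>W - t\<close>.\<close>
    have "?W x - t x \<in> {x. ?W x + t x = 0}" for x
    proof -
      have "t (X v) = X (t v)" for v by (simp add: X_def t.diff)
      from sqrt_op_commute[OF t.bounded_linear this] have "t (?W x) = ?W (t x)" .
      then show ?thesis
        by (simp add: W.diff t.diff sqrt_op_sqrt_op) (simp add: X_def)
    qed
    then have "?W x - t x = 0" for x unfolding 1 by blast
    then show ?thesis by simp
  next
    case 2
    then have "?W x + t x = 0" for x by blast
    then show ?thesis by (metis add.commute eq_neg_iff_add_eq_0)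
  qed
  have W_nonneg: "0 \<le> rinner x (?W x)" for x
  proof -
    have s1: "(\<lambda>n. sqrt_coeff n * (norm x)\<^sup>2) sums (suminf sqrt_coeff * (norm x)\<^sup>2)"
      by (rule sums_mult2[OF summable_sums[OF summable_sqrt_coeff]])
    have s2: "(\<lambda>n. rinner x (sqrt_coeff n *\<^sub>R (X ^^ n) x)) sums rinner x (?W x)"
      unfolding sqrt_op_def
      by (rule bounded_linear.sums[OF rinner.bounded_linear_ip_right
            summable_sums[OF summable_sqrt_op]])
    \<comment> \<open>Comparison with the series in which \<open>X\<close> is the identity: the
      terms at 0 agree, and later coefficients are nonpositive while
      \<open>rinner x ((X ^^ n) x)\<close> is at most the squared norm.\<close>
    have le: "sqrt_coeff n * (norm x)\<^sup>2 \<le> rinner x (sqrt_coeff n *\<^sub>R (X ^^ n) x)" for n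
    proof (cases n)
      case 0
      then show ?thesis by (simp add: rinner_norm)
    next
      case (Suc m)
      have "rinner x ((X ^^ n) x) \<le> norm x * norm x"
        by (rule order_trans[OF rinner.ip_cauchy_schwarz mult_left_mono[OF norm_funpow norm_ge_zero]])
      then show ?thesis
        using Suc sqrt_coeff_Suc_nonpos[of m]
        unfolding rinner_scaleR_right power2_eq_square by (intro mult_left_mono_neg) auto
    qed
    have "suminf sqrt_coeff * (norm x)\<^sup>2 \<le> rinner x (?W x)"
      by (rule sums_le[OF le s1 s2])
    then show ?thesis
      using suminf_sqrt_coeff_nonneg by (meson mult_nonneg_nonneg order_trans zero_le_power2)
  qed
  show ?thesis
    using W_cases W_nonneg by (auto simp: rinner.ip_minus_right)
qed

lemma selfadjoint_definite:
  assumes t: "intertwiner t" and selfadjoint: "\<And>x y. rinner (t x) y = rinner x (t y)"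
  shows "(\<forall>x. 0 \<le> rinner x (t x)) \<or> (\<forall>x. rinner x (t x) \<le> 0)"
proof -
  obtain K where K: "K > 0" "\<And>x. norm (t x) \<le> norm x * K"
    using bounded_linear.pos_bounded[OF intertwinerD(1)[OF t]] by blast
  have "(\<forall>x. 0 \<le> rinner x (inverse K *\<^sub>R t x)) \<or> (\<forall>x. rinner x (inverse K *\<^sub>R t x) \<le> 0)"
    by (rule selfadjoint_contraction_definite[OF intertwiner_scaleR[OF t]])
       (use K in \<open>auto simp: rinner.ip_simps selfadjoint field_simps\<close>)
  then show ?thesis
    using K by (simp add: rinner_scaleR_right zero_le_mult_iff mult_le_0_iff)
qed

text \<open>A zero of a nonnegative quadratic form is a minimum, so the form has zero derivative
  there in the direction \<open>t v\<close>; this derivative is twice the squared norm of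
  \<open>t v\<close>.\<close>

lemma semidefinite_null_vector:
  assumes "bounded_linear t" and selfadjoint: "\<And>x y. rinner (t x) y = rinner x (t y)"
    and nonneg: "\<And>x. 0 \<le> rinner x (t x)" and null: "rinner v (t v) = 0"
  shows "t v = 0"
proof -
  interpret t: bounded_linear t by fact
  define k where "k = rinner (t v) (t (t v))"
  have *: "0 \<le> 2 * e * (norm (t v))\<^sup>2 + e\<^sup>2 * k" for e
  proof -
    have "rinner v (t (t v)) = (norm (t v))\<^sup>2"
      by (simp add: rinner_norm flip: selfadjoint)
    then show ?thesis
      using nonneg[of "v + e *\<^sub>R t v"] null
      by (simp add: t.add t.scaleR rinner.ip_simps k_def rinner_norm power2_eq_square algebra_simps)
  qed
  have "(norm (t v))\<^sup>2 \<le> 0"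
  proof (cases "k = 0")
    case True
    then show ?thesis using *[of "-1"] by simp
  next
    case False
    then have "k > 0" using nonneg[of "t v"] by (simp add: k_def)
    \<comment> \<open>The inserted value of \<open>e\<close> minimises the quadratic
      polynomial.\<close>
    moreover have "0 \<le> - ((norm (t v))\<^sup>2)\<^sup>2 / k"
      using *[of "- (norm (t v))\<^sup>2 / k"] \<open>k > 0\<close> by (simp add: field_simps power2_eq_square)
    ultimately have "((norm (t v))\<^sup>2)\<^sup>2 \<le> 0"
      by (simp add: zero_le_divide_iff divide_le_0_iff)
    then show ?thesis by simp
  qed
  then show ?thesis by simp
qed

text \<open>Subtracting the Rayleigh quotient \<open>r\<close> of some nonzero \<open>v\<close>
  gives an operator that is semidefinite and null at \<open>v\<close>. It therefore kills
  \<open>v\<close>, and with \<open>v\<close> the whole space.\<close>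

lemma schur_selfadjoint:
  assumes t: "intertwiner t" and selfadjoint: "\<And>x y. rinner (t x) y = rinner x (t y)"
  shows "\<exists>c. \<forall>x. t x = c *\<^sub>C x"
proof -
  interpret t: bounded_linear t by (rule intertwinerD[OF t])
  obtain v :: 'h where v: "v \<noteq> 0"
    using irreducible unfolding irreducible_rep_def by blast
  define r where "r = rinner v (t v) / (norm v)\<^sup>2"
  define s where "s x = t x - r *\<^sub>R x" for x
  have s: "intertwiner s"
    unfolding s_def by (intro intertwiner_diff t intertwiner_scaleR intertwiner_id)
  interpret s: bounded_linear s by (rule intertwinerD[OF s])
  have s_selfadjoint: "rinner (s x) y = rinner x (s y)" for x y
    by (simp add: s_def rinner.ip_simps selfadjoint)
  have null: "rinner v (s v) = 0"
    using v by (simp add: s_def rinner.ip_simps rinner_norm r_def)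
  have "s v = 0"
    using selfadjoint_definite[OF s s_selfadjoint]
  proof
    assume "\<forall>x. 0 \<le> rinner x (s x)"
    then show ?thesis
      by (intro semidefinite_null_vector s_selfadjoint null s.bounded_linear) auto
  next
    assume "\<forall>x. rinner x (s x) \<le> 0"
    then have "- s v = 0"
      using null by (intro semidefinite_null_vector[where t = "\<lambda>x. - s x"] bounded_linear_minus
          s.bounded_linear) (auto simp: rinner.ip_minus_left rinner.ip_minus_right s_selfadjoint)
    then show ?thesis by simp
  qed
  with v intertwiner_kernel[OF s] have "s x = 0" for x by blast
  then have "t x = of_real r *\<^sub>C x" for x by (simp add: s_def scaleC_of_real)
  then show ?thesis by blast
qed

text \<open>Split into real and imaginary parts: \<open>t + t'\<close> and
  \<open>\<i> *\<^sub>C (t - t')\<close> are selfadjoint intertwiners. The adjoint is supplied as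
  \<open>t'\<close>; later both are matrix entries of one projection.\<close>

lemma schur:
  assumes t: "intertwiner t" and t': "intertwiner t'"
    and adjoint: "\<And>x y. rinner (t x) y = rinner x (t' y)"
  shows "\<exists>c. \<forall>x. t x = c *\<^sub>C x"
proof -
  have adjoint': "rinner (t' x) y = rinner x (t y)" for x y
    using adjoint rinner_commute by metis
  obtain c where c: "\<And>x. t x + t' x = c *\<^sub>C x"
    using schur_selfadjoint[OF intertwiner_add[OF t t']]
    by (auto simp: rinner.ip_simps adjoint adjoint')
  obtain d where d: "\<And>x. \<i> *\<^sub>C (t x - t' x) = d *\<^sub>C x"
    using schur_selfadjoint[OF intertwiner_scaleC[OF intertwiner_diff[OF t t'], of \<i>]]
    by (auto simp: rinner.ip_simps adjoint adjoint' rinner_scaleC intertwinerD(2)[OF t]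
        intertwinerD(2)[OF t'] scaleC_minus_left rinner.ip_minus_right scaleC_diff_right)
  have "t x = ((c - \<i> * d) / 2) *\<^sub>C x" for x
  proof -
    have "- (t x - t' x) = \<i> *\<^sub>C \<i> *\<^sub>C (t x - t' x)"
      by (simp add: scaleC_scaleC scaleC_minus1)
    then have "2 *\<^sub>C t x = (c - \<i> * d) *\<^sub>C x"
      using scaleC_add_left[of 1 1 "t x"] c[of x]
      by (simp add: d scaleC_scaleC scaleC_diff_left algebra_simps)
    then have "(1/2) *\<^sub>C 2 *\<^sub>C t x = (1/2) *\<^sub>C (c - \<i> * d) *\<^sub>C x" by simp
    then show ?thesis by (simp only: scaleC_scaleC) simp
  qed
  then show ?thesis by blast
qed

text \<open>The vectors killed by all \<open>a * x\<close> form a closed invariant subspace, which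
  is not everything because \<open>x = 1\<close> is allowed and \<open>a\<close> acts
  nontrivially.\<close>

lemma rep_prime:
  assumes "\<And>x. \<pi> (a * x) v = 0" and "\<exists>w. \<pi> a w \<noteq> 0"
  shows "v = 0"
proof -
  have "{v. \<forall>x. \<pi> (a * x) v = 0} = {0} \<or> {v. \<forall>x. \<pi> (a * x) v = 0} = UNIV"
  proof (rule invariant_subspace_trivial)
    show "csubspace {v. \<forall>x. \<pi> (a * x) v = 0}"
      by (simp add: csubspace_def rep_add_right rep_scaleC_right)
    show "closed {v. \<forall>x. \<pi> (a * x) v = 0}"
      by (intro closed_Collect_all closed_Collect_eq continuous_on_const
          linear_continuous_on[OF bounded_linear_rep])
    show "\<pi> b u \<in> {v. \<forall>x. \<pi> (a * x) v = 0}" if "u \<in> {v. \<forall>x. \<pi> (a * x) v = 0}" for b u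
    proof -
      have "\<pi> (a * x) (\<pi> b u) = \<pi> (a * (x * b)) u" for x
        by (simp only: rep_mult mult.assoc)
      with that show ?thesis by simp
    qed
  qed
  moreover obtain w where "\<pi> (a * 1) w \<noteq> 0"
    using assms(2) by auto
  ultimately show ?thesis
    using assms(1) by blast
qed

end

subsection \<open>Primitive algebras\<close>

lemma primitive_onE:
  assumes "primitive_on TYPE('h::chilbert_space) TYPE('a::cstar_algebra)"
  obtains \<pi> :: "'a::cstar_algebra \<Rightarrow> 'h::chilbert_space \<Rightarrow> 'h" where "irreducible_star_rep \<pi>" "inj \<pi>"
  using assms unfolding primitive_on_def irreducible_star_rep_def by blast

lemma (in irreducible_star_rep) rep_eq_0_iff:
  assumes "inj \<pi>"
  shows "(\<forall>v. \<pi> a v = 0) \<longleftrightarrow> a = 0"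
proof
  assume "\<forall>v. \<pi> a v = 0"
  then have "\<pi> a = \<pi> 0" by (simp add: fun_eq_iff)
  then show "a = 0" using assms by (simp add: inj_eq)
qed simp

lemma primitive_imp_prime:
  fixes a b :: "'a::cstar_algebra"
  assumes primitive: "primitive_on TYPE('h::chilbert_space) TYPE('a)"
    and annihilate: "\<And>x. a * x * b = 0" and "a \<noteq> 0"
  shows "b = 0"
proof -
  obtain \<pi> :: "'a \<Rightarrow> 'h \<Rightarrow> 'h" where "irreducible_star_rep \<pi>" and inj: "inj \<pi>"
    using primitive by (rule primitive_onE)
  then interpret irreducible_star_rep \<pi> by simp
  have "\<pi> b v = 0" for v
  proof (rule rep_prime)
    show "\<pi> (a * x) (\<pi> b v) = 0" for x
      by (simp add: annihilate flip: rep_mult[of "a * x"])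
    show "\<exists>w. \<pi> a w \<noteq> 0"
      using rep_eq_0_iff[OF inj] \<open>a \<noteq> 0\<close> by blast
  qed
  then show ?thesis using rep_eq_0_iff[OF inj] by blast
qed

text \<open>Formally \<open>a * b\<^sup>-\<^sup>1\<close> commutes with the whole algebra. Its closed graph \<open>S\<close> is an invariant
  subspace of the doubled Hilbert space, and the matrix entries of the projection onto \<open>S\<close>
  are scalars by Schur's lemma.\<close>

lemma primitive_exchange_imp_proportional:
  fixes a b :: "'a::cstar_algebra"
  assumes primitive: "primitive_on TYPE('h::chilbert_space) TYPE('a)"
    and exchange: "\<And>x. a * x * b = b * x * a" and "b \<noteq> 0"
  shows "\<exists>c. a = c *\<^sub>C b"
proof -
  obtain \<pi> :: "'a \<Rightarrow> 'h \<Rightarrow> 'h" where "irreducible_star_rep \<pi>" and inj: "inj \<pi>"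
    using primitive by (rule primitive_onE)
  then interpret irreducible_star_rep \<pi> by simp
  \<comment> \<open>Formally \<open>snd p\<close> is the image of \<open>fst p\<close> under the
    quotient of \<open>a\<close> by \<open>b\<close>. Quantifying over \<open>x\<close> makes
    \<open>S\<close> invariant under the representation.\<close>
  define S where "S = {p. \<forall>x. \<pi> (b * x) (snd p) = \<pi> (a * x) (fst p)}"
  have S_D: "\<pi> (b * x) w = \<pi> (a * x) u" if "(u, w) \<in> S" for u w x
    using that by (simp add: S_def)
  have S_graph: "w = 0" if "(0, w) \<in> S" for w
    using rep_prime[of b w] S_D[OF that] rep_eq_0_iff[OF inj, of b] \<open>b \<noteq> 0\<close> by auto
  have S_ba: "(\<pi> b v, \<pi> a v) \<in> S" for v
    by (simp add: S_def exchange flip: rep_mult)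
  have subspace_S: "subspace S"
  proof (rule subspaceI)
    show "r *\<^sub>R p \<in> S" if "p \<in> S" for r p
      using that by (simp add: S_def rep_scaleC_right flip: scaleC_of_real)
  qed (auto simp: S_def rep_add_right)
  have S_rep: "map_prod (\<pi> x) (\<pi> x) p \<in> S" if "p \<in> S" for x p
    using that by (simp add: S_def mult.assoc flip: rep_mult)
  have S_scaleC: "map_prod (scaleC c) (scaleC c) p \<in> S" if "p \<in> S" for c p
    using that by (simp add: S_def rep_scaleC_right)
  have closed_S: "closed S"
    unfolding S_def
    by (intro closed_Collect_all closed_Collect_eq
        bounded_linear.continuous_on[OF bounded_linear_rep] continuous_intros)
  interpret closed_subspace_of_inner rinner_prod S
    by unfold_locales (rule closed_S subspace_S)+
  interpret E: bounded_linear E by (rule bounded_linear_proj)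
  have E_rep: "E (map_prod (\<pi> x) (\<pi> x) p) = map_prod (\<pi> x) (\<pi> x) (E p)" for x p
    by (rule proj_commute[where h = "map_prod (\<pi> (star x)) (\<pi> (star x))"])
       (auto intro: S_rep simp: rinner_prod_def rep_diff_right star_star
          simp flip: rep_rinner[of "star x"])
  have E_scaleC: "E (map_prod (scaleC c) (scaleC c) p) = map_prod (scaleC c) (scaleC c) (E p)" for c p
    by (rule proj_commute[where h = "map_prod (scaleC (cnj c)) (scaleC (cnj c))"])
       (auto intro: S_scaleC simp: rinner_prod_def scaleC_diff_right rinner_scaleC)
  note E_rep' = E_rep[of _ "(_, _)", simplified] and E_scaleC' = E_scaleC[of _ "(_, _)", simplified]
  have left: "intertwiner (\<lambda>u. f (E (u, 0)))"
    and right: "intertwiner (\<lambda>w. f (E (0, w)))" if "f = fst \<or> f = snd" for f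
  proof -
    have f: "bounded_linear f"
      using that bounded_linear_fst bounded_linear_snd by blast
    have "bounded_linear (\<lambda>u :: 'h. (u, 0 :: 'h))" "bounded_linear (\<lambda>w :: 'h. (0 :: 'h, w))"
      by (intro bounded_linear_Pair bounded_linear_ident bounded_linear_zero)+
    then have "bounded_linear (\<lambda>u. f (E (u, 0)))" "bounded_linear (\<lambda>w. f (E (0, w)))"
      by (auto intro: bounded_linear_compose[OF f] bounded_linear_compose[OF bounded_linear_proj])
    then show "intertwiner (\<lambda>u. f (E (u, 0)))" "intertwiner (\<lambda>w. f (E (0, w)))"
      using that E_rep'[of _ _ 0] E_rep'[of _ 0] E_scaleC'[of _ _ 0] E_scaleC'[of _ 0]
      by (auto simp: intertwiner_def)
  qed
  have adj: "rinner_prod (E p) q = rinner_prod p (E q)" for p q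
    by (rule proj_selfadjoint)
  have rinner_0 [simp]: "rinner x 0 = 0" "rinner 0 x = 0" for x :: 'h
    using rinner.ip_scaleR_right[of x 0 0] rinner.ip_scaleR_left[of 0 0 x] by auto
  \<comment> \<open>The projection is selfadjoint, so the adjoint of each matrix entry is the
    transposed entry, again an intertwiner.\<close>
  obtain e11 where e11: "\<And>u. fst (E (u, 0)) = e11 *\<^sub>C u"
    using schur[OF left left, of fst fst] adj[of "(_, 0)" "(_, 0)"] by (auto simp: rinner_prod_def)
  obtain e21 where e21: "\<And>u. snd (E (u, 0)) = e21 *\<^sub>C u"
    using schur[OF left right, of snd fst] adj[of "(_, 0)" "(0, _)"] by (auto simp: rinner_prod_def)
  obtain e12 where e12: "\<And>w. fst (E (0, w)) = e12 *\<^sub>C w"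
    using schur[OF right left, of fst snd] adj[of "(0, _)" "(_, 0)"] by (auto simp: rinner_prod_def)
  obtain e22 where e22: "\<And>w. snd (E (0, w)) = e22 *\<^sub>C w"
    using schur[OF right right, of snd snd] adj[of "(0, _)" "(0, _)"] by (auto simp: rinner_prod_def)
  have E_eq: "E (u, w) = (e11 *\<^sub>C u + e12 *\<^sub>C w, e21 *\<^sub>C u + e22 *\<^sub>C w)" for u w
    using E.add[of "(u, 0)" "(0, w)"] by (simp add: prod_eq_iff e11 e12 e21 e22)
  have E_ba: "e11 *\<^sub>C \<pi> b v + e12 *\<^sub>C \<pi> a v = \<pi> b v" "e21 *\<^sub>C \<pi> b v + e22 *\<^sub>C \<pi> a v = \<pi> a v" for v
    using proj_id[OF S_ba[of v]] by (simp_all add: E_eq)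
  have solve: "a = (d / e) *\<^sub>C b" if "e \<noteq> 0" "\<And>v. e *\<^sub>C \<pi> a v = d *\<^sub>C \<pi> b v" for d e
  proof -
    have "\<pi> a v = \<pi> ((d / e) *\<^sub>C b) v" for v
    proof -
      have "\<pi> a v = inverse e *\<^sub>C e *\<^sub>C \<pi> a v"
        using \<open>e \<noteq> 0\<close> by (simp add: scaleC_scaleC)
      then show ?thesis
        by (simp add: that(2) scaleC_scaleC rep_scaleC_left divide_inverse mult.commute)
    qed
    then show ?thesis using inj by (simp add: inj_def fun_eq_iff)
  qed
  \<comment> \<open>The projection fixes every pair \<open>(\<pi> b v, \<pi> a v)\<close>; each
    coordinate gives a linear relation between \<open>a\<close> and \<open>b\<close>. If
    \<open>a\<close> dropped out of both, all pairs \<open>(0, w)\<close> would lie in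
    \<open>S\<close>, which is a graph.\<close>
  show ?thesis
  proof (cases "e12 = 0")
    case False
    have "e12 *\<^sub>C \<pi> a v = (1 - e11) *\<^sub>C \<pi> b v" for v
      using E_ba(1)[of v] by (simp add: scaleC_diff_left algebra_simps)
    with solve False show ?thesis by blast
  next
    case e12_0: True
    have "e22 \<noteq> 1"
    proof
      assume "e22 = 1"
      then have "(0, w) \<in> S" for w
        using proj_in[of "(0, w)"] by (simp add: E_eq e12_0)
      then have "\<pi> b v = 0" for v using S_graph by blast
      with rep_eq_0_iff[OF inj] \<open>b \<noteq> 0\<close> show False by blast
    qed
    have "(1 - e22) *\<^sub>C \<pi> a v = e21 *\<^sub>C \<pi> b v" for v
      using E_ba(2)[of v] by (simp add: scaleC_diff_left algebra_simps)
    with solve[of "1 - e22"] \<open>e22 \<noteq> 1\<close> show ?thesis by auto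
  qed
qed

subsection \<open>Regular resolvents\<close>

context flat_lie_cstar_system
begin

lemma primitive_TYPE: "primitive_on TYPE('h) TYPE('a)"
  using primitive by (simp add: primitive_on_def)

lemma A0_0: "0 \<in> A0" and A0_1: "1 \<in> A0"
  and A0_add: "a \<in> A0 \<Longrightarrow> b \<in> A0 \<Longrightarrow> a + b \<in> A0"
  and A0_mult: "a \<in> A0 \<Longrightarrow> b \<in> A0 \<Longrightarrow> a * b \<in> A0"
  and A0_scaleC: "a \<in> A0 \<Longrightarrow> c *\<^sub>C a \<in> A0"
  using subalgebra by (auto simp: unital_star_subalgebra_def csubspace_def)

lemma A0_diff: "a \<in> A0 \<Longrightarrow> b \<in> A0 \<Longrightarrow> a - b \<in> A0"
  using A0_add[of a "- b"] A0_scaleC[of b "- 1"] by (simp add: scaleC_minus1)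

lemma A0_scaleR: "a \<in> A0 \<Longrightarrow> r *\<^sub>R a \<in> A0"
  using A0_scaleC[of a "of_real r"] by (simp add: scaleC_of_real)

lemma A0_sum: "(\<And>i. i \<in> I \<Longrightarrow> a i \<in> A0) \<Longrightarrow> (\<Sum>i\<in>I. a i) \<in> A0"
  by (induction I rule: infinite_finite_induct) (auto intro: A0_0 A0_add)

lemma deriv_A0: "a \<in> A0 \<Longrightarrow> \<delta> f a \<in> A0"
  and deriv_add: "a \<in> A0 \<Longrightarrow> b \<in> A0 \<Longrightarrow> \<delta> f (a + b) = \<delta> f a + \<delta> f b"
  and deriv_scaleC: "a \<in> A0 \<Longrightarrow> \<delta> f (c *\<^sub>C a) = c *\<^sub>C \<delta> f a"
  and deriv_mult: "a \<in> A0 \<Longrightarrow> b \<in> A0 \<Longrightarrow> \<delta> f (a * b) = \<delta> f a * b + a * \<delta> f b"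
  and deriv_star: "a \<in> A0 \<Longrightarrow> \<delta> f (star a) = star (\<delta> f a)"
  using derivation[of f] by (auto simp: star_derivation_on_def)

lemma deriv_0: "\<delta> f 0 = 0"
  using deriv_scaleC[OF A0_0, of f 0] by simp

lemma deriv_diff: "a \<in> A0 \<Longrightarrow> b \<in> A0 \<Longrightarrow> \<delta> f (a - b) = \<delta> f a - \<delta> f b"
  using deriv_add[of a "- b" f] A0_scaleC[of b "- 1"] deriv_scaleC[of b f "- 1"]
  by (simp add: scaleC_minus1)

lemma deriv_sum: "(\<And>i. i \<in> I \<Longrightarrow> a i \<in> A0) \<Longrightarrow> \<delta> f (\<Sum>i\<in>I. a i) = (\<Sum>i\<in>I. \<delta> f (a i))"
  by (induction I rule: infinite_finite_induct) (auto simp: deriv_0 deriv_add A0_sum)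

lemma deriv_zero_left: "a \<in> A0 \<Longrightarrow> \<delta> 0 a = 0"
  using linear_0[OF linear_action] by simp

lemma R_A0:
  assumes "\<kappa> \<noteq> 0"
  shows "R \<kappa> f \<in> A0"
proof -
  obtain F where "analytic_continuation F (\<lambda>\<kappa>. R \<kappa> f)" "\<And>z. Re z \<noteq> 0 \<Longrightarrow> F z \<in> A0"
    using continuation_in_A0[of f] by blast
  with assms show ?thesis
    unfolding analytic_continuation_def by (metis Re_complex_of_real)
qed

lemma resolvent_eq:
  "\<kappa> \<noteq> 0 \<Longrightarrow> \<mu> \<noteq> 0 \<Longrightarrow> R \<kappa> f - R \<mu> f = (\<i> * of_real (\<mu> - \<kappa>)) *\<^sub>C (R \<kappa> f * R \<mu> f)"
  and star_R: "\<kappa> \<noteq> 0 \<Longrightarrow> star (R \<kappa> f) = R (- \<kappa>) f"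
  using resolvent[of f] by (auto simp: pseudo_resolvent_def)

lemma R_commute:
  assumes "\<kappa> \<noteq> 0" "\<mu> \<noteq> 0"
  shows "R \<kappa> f * R \<mu> f = R \<mu> f * R \<kappa> f"
proof (cases "\<kappa> = \<mu>")
  case False
  define k where "k = \<i> * of_real (\<mu> - \<kappa>)"
  have "R \<mu> f - R \<kappa> f = (- k) *\<^sub>C (R \<mu> f * R \<kappa> f)"
    using resolvent_eq[OF assms(2,1), of f] by (simp add: k_def algebra_simps)
  moreover have "R \<kappa> f - R \<mu> f = k *\<^sub>C (R \<kappa> f * R \<mu> f)"
    using resolvent_eq[OF assms] by (simp add: k_def)
  ultimately have "k *\<^sub>C (R \<kappa> f * R \<mu> f) = k *\<^sub>C (R \<mu> f * R \<kappa> f)"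
    by (metis minus_diff_eq minus_minus scaleC_minus_left)
  then show ?thesis using False by (simp add: k_def)
qed simp

section \<open>Cancellation of nonzero resolvents\<close>

text \<open>The parameter 1 is a convenient choice: by the resolvent equation, vanishing at one
  nonzero parameter forces vanishing at all of them.\<close>

definition regular :: "'x \<Rightarrow> bool" where
  "regular f \<longleftrightarrow> R 1 f \<noteq> 0"

lemma regular_iff:
  assumes "\<kappa> \<noteq> 0"
  shows "regular f \<longleftrightarrow> R \<kappa> f \<noteq> 0"
  using resolvent_eq[OF assms, of 1 f] resolvent_eq[OF _ assms, of 1 f]
  by (auto simp: regular_def)

text \<open>Moves a resolvent to the left past \<open>a\<close>; the correction again has the
  resolvent on both sides, so annihilators are stable under multiplication by
  \<open>a\<close>.\<close>

lemma mult_R: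
  assumes "\<kappa> \<noteq> 0" "a \<in> A0"
  shows "a * R \<kappa> f = R \<kappa> f * a - \<i> *\<^sub>C (R \<kappa> f * \<delta> f a * R \<kappa> f)"
  by (simp add: resolvent_derivation[OF assms] commutator_def scaleC_scaleC scaleC_minus1)

lemma A0_dense_eq:
  fixes p q :: "'a \<Rightarrow> 'a"
  assumes "\<And>a. a \<in> A0 \<Longrightarrow> p a = q a" "continuous_on UNIV p" "continuous_on UNIV q"
  shows "p x = q x"
proof -
  have "closed {x. p x = q x}"
    using assms(2,3) by (rule closed_Collect_eq)
  then have "closure A0 \<subseteq> {x. p x = q x}"
    using assms(1) by (intro closure_minimal) auto
  then show ?thesis using dense by auto
qed

text \<open>The left annihilator and the right annihilator of a resolvent are two-sided ideals.\<close>

lemma R_cancel_left: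
  assumes "regular f" "\<kappa> \<noteq> 0" "R \<kappa> f * b = 0"
  shows "b = 0"
proof (rule primitive_imp_prime[OF primitive_TYPE])
  show "R \<kappa> f \<noteq> 0" using assms regular_iff by simp
  show "R \<kappa> f * x * b = 0" for x
  proof (rule A0_dense_eq[where p = "\<lambda>x. R \<kappa> f * x * b" and q = "\<lambda>_. 0"])
    fix a assume "a \<in> A0"
    then have "R \<kappa> f * a = a * R \<kappa> f + \<i> *\<^sub>C (R \<kappa> f * \<delta> f a * R \<kappa> f)"
      using mult_R[OF assms(2)] by simp
    then show "R \<kappa> f * a * b = 0"
      by (simp add: distrib_right mult_scaleC_left mult.assoc assms(3))
  qed (intro continuous_intros)+
qed

lemma R_cancel_right:
  assumes "regular f" "\<kappa> \<noteq> 0" "b * R \<kappa> f = 0"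
  shows "b = 0"
proof (rule ccontr)
  assume "b \<noteq> 0"
  have "R \<kappa> f = 0"
  proof (rule primitive_imp_prime[OF primitive_TYPE _ \<open>b \<noteq> 0\<close>])
    show "b * x * R \<kappa> f = 0" for x
    proof (rule A0_dense_eq[where p = "\<lambda>x. b * x * R \<kappa> f" and q = "\<lambda>_. 0"])
      fix a assume "a \<in> A0"
      have "b * a * R \<kappa> f = b * (R \<kappa> f * a - \<i> *\<^sub>C (R \<kappa> f * \<delta> f a * R \<kappa> f))"
        by (simp add: mult_R[OF assms(2) \<open>a \<in> A0\<close>] mult.assoc)
      also have "\<dots> = 0"
        by (simp add: right_diff_distrib mult_scaleC_right assms(3) flip: mult.assoc)
      finally show "b * a * R \<kappa> f = 0" .
    qed (intro continuous_intros)+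
  qed
  with assms regular_iff show False by simp
qed

lemma R_eq_cancel_left:
  "regular f \<Longrightarrow> \<kappa> \<noteq> 0 \<Longrightarrow> R \<kappa> f * a = R \<kappa> f * b \<Longrightarrow> a = b"
  using R_cancel_left[of f \<kappa> "a - b"] by (simp add: right_diff_distrib)

text \<open>A resolvent commutes with itself, so \<open>resolvent_derivation\<close> gives zero, and
  the outer factors cancel.\<close>

lemma deriv_R_self:
  assumes "regular f" "\<kappa> \<noteq> 0"
  shows "\<delta> f (R \<kappa> f) = 0"
proof -
  have "R \<kappa> f * \<delta> f (R \<kappa> f) * R \<kappa> f = 0"
    using resolvent_derivation[OF assms(2) R_A0[OF assms(2)]] by (simp add: commutator_def)
  with assms R_cancel_left R_cancel_right show ?thesis by blast
qed

section \<open>Derivatives of resolvents\<close>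

lemma deriv_R_proportional:
  assumes "regular g" "\<mu> \<noteq> 0"
  shows "\<exists>c. \<delta> f (R \<mu> g) = c *\<^sub>C (R \<mu> g)\<^sup>2"
proof -
  define r D where "r = R \<mu> g" and "D = \<delta> f (R \<mu> g)"
  have r: "r \<in> A0" and D: "D \<in> A0"
    by (auto simp: r_def D_def assms R_A0 deriv_A0)
  have rel: "r * \<delta> g a * r = \<i> *\<^sub>C (a * r - r * a)" if "a \<in> A0" for a
    using resolvent_derivation[OF assms(2) that] by (simp add: r_def commutator_def)
  \<comment> \<open>Differentiate \<open>rel\<close> along \<open>f\<close>. The terms containing
    \<open>\<delta> f a\<close> cancel by \<open>rel\<close> applied to \<open>\<delta> f a\<close>,
    since the derivations commute.\<close>
  have rel_D: "D * \<delta> g a * r + r * \<delta> g a * D = \<i> *\<^sub>C (a * D - D * a)" if a: "a \<in> A0" for a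
  proof -
    have "\<delta> f (r * \<delta> g a * r) = D * \<delta> g a * r + r * \<delta> g (\<delta> f a) * r + r * \<delta> g a * D"
      using a r by (simp add: deriv_mult A0_mult deriv_A0 commuting_action[of a f g] distrib_right
          flip: r_def D_def[folded r_def])
    moreover have "\<delta> f (\<i> *\<^sub>C (a * r - r * a))
        = \<i> *\<^sub>C (\<delta> f a * r - r * \<delta> f a) + \<i> *\<^sub>C (a * D - D * a)"
      using a r by (simp add: deriv_scaleC deriv_diff deriv_mult A0_mult A0_diff algebra_simps
          flip: r_def D_def[folded r_def] scaleC_add_right)
    ultimately show ?thesis
      using rel[OF a] rel[OF deriv_A0[OF a]] by (simp add: algebra_simps)
  qed
  \<comment> \<open>At \<open>a = r\<close> the left side of \<open>rel_D\<close> vanishes because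
    \<open>\<delta> g r = 0\<close>.\<close>
  have comm: "D * r = r * D"
    using rel_D[OF r] deriv_R_self[OF assms] by (simp add: r_def)
  have exchange: "D * a * r\<^sup>2 = r\<^sup>2 * a * D" if a: "a \<in> A0" for a
  proof -
    \<comment> \<open>Multiplying \<open>rel_D\<close> by \<open>r\<close> on both sides and moving
      \<open>D\<close> outwards produces factors \<open>r * \<delta> g a * r\<close>, which
      \<open>rel\<close> eliminates.\<close>
    have "r * (D * \<delta> g a * r + r * \<delta> g a * D) * r
        = D * (r * \<delta> g a * r) * r + r * (r * \<delta> g a * r) * D"
      by (simp add: distrib_left distrib_right mult.assoc comm)
        (simp add: comm flip: mult.assoc)
    then have "\<i> *\<^sub>C (r * (a * D - D * a) * r)
        = \<i> *\<^sub>C (D * (a * r - r * a) * r + r * (a * r - r * a) * D)"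
      by (simp add: rel[OF a] rel_D[OF a] mult_scaleC_left mult_scaleC_right scaleC_add_right)
    then have "r * (a * D - D * a) * r = D * (a * r - r * a) * r + r * (a * r - r * a) * D"
      by (simp only: scaleC_cancel_left) simp
    moreover have "r * (a * D) * r = r * (a * r) * D" "r * (D * a) * r = D * (r * a) * r"
      by (simp_all add: mult.assoc comm) (simp add: comm flip: mult.assoc)
    moreover have "w = z" if "u - v = w - v + (u - z)" for u v w z :: 'a
      using that by (simp add: algebra_simps)
    ultimately have "D * (a * r) * r = r * (r * a) * D"
      unfolding right_diff_distrib left_diff_distrib by metis
    then show ?thesis
      by (simp add: power2_eq_square mult.assoc)
  qed
  have "D * x * r\<^sup>2 = r\<^sup>2 * x * D" for x
    by (rule A0_dense_eq[where p = "\<lambda>x. D * x * r\<^sup>2" and q = "\<lambda>x. r\<^sup>2 * x * D"])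
      (erule exchange, (intro continuous_intros)+)
  moreover have "r\<^sup>2 \<noteq> 0"
    using R_cancel_left[OF assms, of r] assms regular_iff by (auto simp: r_def power2_eq_square)
  ultimately show ?thesis
    using primitive_exchange_imp_proportional[OF primitive_TYPE] by (simp add: D_def r_def)
qed

text \<open>Differentiate the resolvent equation and rewrite the squares by that same equation. The
  cubic terms cancel, leaving \<open>c - d\<close> times the nonzero product of the two
  resolvents.\<close>

lemma deriv_R_const:
  assumes g: "regular g" and \<kappa>\<mu>: "\<kappa> \<noteq> 0" "\<mu> \<noteq> 0"
    and c: "\<delta> f (R \<kappa> g) = c *\<^sub>C (R \<kappa> g)\<^sup>2" and d: "\<delta> f (R \<mu> g) = d *\<^sub>C (R \<mu> g)\<^sup>2"
  shows "c = d"
proof -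
  define x y k where "x = R \<kappa> g" and "y = R \<mu> g" and "k = \<i> * of_real (\<mu> - \<kappa>)"
  have A0: "x \<in> A0" "y \<in> A0" by (auto simp: x_def y_def R_A0 \<kappa>\<mu>)
  have comm: "y * x = x * y" using R_commute \<kappa>\<mu> by (simp add: x_def y_def)
  have res: "x - y = k *\<^sub>C (x * y)" using resolvent_eq \<kappa>\<mu> by (simp add: x_def y_def k_def)
  define p q where "p = x * (x * y)" and "q = x * y * y"
  have "x * (x - y) = k *\<^sub>C p" "(x - y) * y = k *\<^sub>C q"
    by (simp_all only: res mult_scaleC_left mult_scaleC_right p_def q_def)
  then have xx: "x * x = x * y + k *\<^sub>C p" and yy: "y * y = x * y - k *\<^sub>C q"
    by (simp_all only: right_diff_distrib left_diff_distrib) (simp_all add: algebra_simps)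
  have "\<delta> f (x - y) = k *\<^sub>C (\<delta> f x * y + x * \<delta> f y)"
    using A0 by (simp add: res deriv_scaleC A0_mult deriv_mult)
  then have "c *\<^sub>C (x * x) - d *\<^sub>C (y * y) = k *\<^sub>C c *\<^sub>C p + k *\<^sub>C d *\<^sub>C q"
    using A0 c d by (simp add: deriv_diff x_def y_def power2_eq_square mult_scaleC_left
        mult_scaleC_right scaleC_add_right mult.assoc p_def q_def)
  then have "c *\<^sub>C (x * y + k *\<^sub>C p) - d *\<^sub>C (x * y - k *\<^sub>C q) = k *\<^sub>C c *\<^sub>C p + k *\<^sub>C d *\<^sub>C q"
    by (simp only: xx yy)
  then have "(c - d) *\<^sub>C (x * y) = 0"
    by (simp add: scaleC_add_right scaleC_diff_right scaleC_diff_left scaleC_scaleC mult.commute)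
  moreover have "x * y \<noteq> 0"
    using R_cancel_left[OF g, of \<kappa> y] regular_iff g \<kappa>\<mu> by (auto simp: x_def y_def)
  ultimately show ?thesis by simp
qed

text \<open>The star takes parameter 1 to -1 and \<open>c\<close> to its conjugate, while the
  constant does not depend on the parameter.\<close>

lemma deriv_R_real:
  assumes g: "regular g"
  shows "\<exists>r :: real. \<forall>\<mu>. \<mu> \<noteq> 0 \<longrightarrow> \<delta> f (R \<mu> g) = r *\<^sub>R (R \<mu> g)\<^sup>2"
proof -
  obtain c where c1: "\<delta> f (R 1 g) = c *\<^sub>C (R 1 g)\<^sup>2"
    using deriv_R_proportional[OF g, of 1] by auto
  have c: "\<delta> f (R \<mu> g) = c *\<^sub>C (R \<mu> g)\<^sup>2" if \<mu>: "\<mu> \<noteq> 0" for \<mu>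
  proof -
    obtain d where d: "\<delta> f (R \<mu> g) = d *\<^sub>C (R \<mu> g)\<^sup>2"
      using deriv_R_proportional[OF g \<mu>] by blast
    moreover have "d = c"
      by (rule deriv_R_const[OF g \<mu> _ d c1]) simp
    ultimately show ?thesis by simp
  qed
  have c_minus: "\<delta> f (R (- 1) g) = cnj c *\<^sub>C (R (- 1) g)\<^sup>2"
    using deriv_star[OF R_A0, of 1 f g] by (simp add: star_R c1 star_scaleC star_mult power2_eq_square)
  have "cnj c = c"
    by (rule deriv_R_const[OF g _ _ c_minus c1]) simp_all
  then have "of_real (Re c) = c"
    by (simp add: of_real_Re Reals_cnj_iff)
  then have "\<delta> f (R \<mu> g) = Re c *\<^sub>R (R \<mu> g)\<^sup>2" if "\<mu> \<noteq> 0" for \<mu>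
    using c[OF that] by (metis scaleC_of_real)
  then show ?thesis by blast
qed

text \<open>A junk value if \<open>g\<close> is not regular.\<close>

definition sigma :: "'x \<Rightarrow> 'x \<Rightarrow> real" where
  "sigma f g = (SOME r. \<forall>\<mu>. \<mu> \<noteq> 0 \<longrightarrow> \<delta> f (R \<mu> g) = r *\<^sub>R (R \<mu> g)\<^sup>2)"

lemma deriv_R: "regular g \<Longrightarrow> \<mu> \<noteq> 0 \<Longrightarrow> \<delta> f (R \<mu> g) = sigma f g *\<^sub>R (R \<mu> g)\<^sup>2"
  unfolding sigma_def using someI_ex[OF deriv_R_real[of g f]] by blast

lemma R_power2_nonzero: "regular g \<Longrightarrow> \<mu> \<noteq> 0 \<Longrightarrow> (R \<mu> g)\<^sup>2 \<noteq> 0"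
  using R_cancel_left[of g \<mu> "R \<mu> g"] regular_iff by (auto simp: power2_eq_square)

lemma linear_sigma_left:
  assumes "regular g"
  shows "linear (\<lambda>f. sigma f g)"
proof -
  have R: "R 1 g \<in> A0" by (simp add: R_A0)
  have nz: "(R 1 g)\<^sup>2 \<noteq> 0" using assms by (simp add: R_power2_nonzero)
  show ?thesis
  proof (rule linearI)
    fix f f' :: 'x and r :: real
    have "sigma (f + f') g *\<^sub>R (R 1 g)\<^sup>2 = (sigma f g + sigma f' g) *\<^sub>R (R 1 g)\<^sup>2"
      using linear_add[OF linear_action[OF R], of f f'] assms by (simp add: deriv_R scaleR_add_left)
    with nz show "sigma (f + f') g = sigma f g + sigma f' g" by simp
    have "sigma (r *\<^sub>R f) g *\<^sub>R (R 1 g)\<^sup>2 = (r * sigma f g) *\<^sub>R (R 1 g)\<^sup>2"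
      using linear_scale[OF linear_action[OF R], of r f] assms by (simp add: deriv_R)
    with nz show "sigma (r *\<^sub>R f) g = r *\<^sub>R sigma f g" by simp
  qed
qed

section \<open>Commutators and antisymmetry\<close>

lemma commutator_R:
  assumes "regular f" "regular g" "\<kappa> \<noteq> 0" "\<mu> \<noteq> 0"
  shows "commutator (R \<kappa> f) (R \<mu> g)
    = (\<i> * of_real (sigma f g)) *\<^sub>C (R \<kappa> f * (R \<mu> g)\<^sup>2 * R \<kappa> f)"
proof -
  have "of_real (sigma f g) *\<^sub>C (R \<kappa> f * (R \<mu> g)\<^sup>2 * R \<kappa> f)
      = \<i> *\<^sub>C commutator (R \<mu> g) (R \<kappa> f)"
    using resolvent_derivation[OF assms(3) R_A0[OF assms(4)], of f g]
    by (simp add: deriv_R assms scaleC_of_real)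
  then have "\<i> *\<^sub>C of_real (sigma f g) *\<^sub>C (R \<kappa> f * (R \<mu> g)\<^sup>2 * R \<kappa> f)
      = \<i> *\<^sub>C \<i> *\<^sub>C commutator (R \<mu> g) (R \<kappa> f)"
    by simp
  then show ?thesis
    by (simp add: scaleC_scaleC scaleC_minus1 commutator_def)
qed

text \<open>If \<open>\<sigma>(f, g) + \<sigma>(g, f) \<noteq> 0\<close>, the two commutator relations force \<open>m = R 1 f * R 1 g\<close> to be a scalar.
  But then the commutator, and with it the form, vanishes.\<close>

lemma sigma_antisymmetric:
  assumes "regular f" "regular g"
  shows "sigma f g = - sigma g f"
proof (rule ccontr)
  define x y where "x = R 1 f" and "y = R 1 g"
  define m n where "m = x * y" and "n = y * x"
  define s t where "s = complex_of_real (sigma f g)" and "t = complex_of_real (sigma g f)"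
  assume "sigma f g \<noteq> - sigma g f"
  then have st: "s + t \<noteq> 0"
    by (simp add: s_def t_def flip: of_real_add)
  \<comment> \<open>The product \<open>x * y\<^sup>2 * x\<close> regroups as \<open>m * n\<close>,
    and \<open>y * x\<^sup>2 * y\<close> as \<open>n * m\<close>.\<close>
  have mn: "m - n = (\<i> * s) *\<^sub>C (m * n)" and nm: "n - m = (\<i> * t) *\<^sub>C (n * m)"
    using commutator_R[OF assms, of 1 1] commutator_R[OF assms(2,1), of 1 1]
    by (simp_all add: commutator_def m_def n_def x_def y_def s_def t_def power2_eq_square mult.assoc)
  have cancel: "b = 0" if "n * m * b = 0" for b
    using that R_cancel_left[OF assms(1), of 1] R_cancel_left[OF assms(2), of 1]
    by (metis mult.assoc m_def n_def x_def y_def one_neq_zero)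
  have "\<i> *\<^sub>C (s *\<^sub>C (m * n) + t *\<^sub>C (n * m)) = (m - n) + (n - m)"
    unfolding mn nm by (simp add: scaleC_add_right scaleC_scaleC)
  then have sum: "s *\<^sub>C (m * n) = - (t *\<^sub>C (n * m))"
    by (simp add: eq_neg_iff_add_eq_0)
  \<comment> \<open>Taking the commutator of \<open>m\<close> with \<open>nm\<close> expresses
    \<open>X\<close> as a multiple of \<open>X * m\<close>, while \<open>sum\<close> makes
    \<open>s *\<^sub>C X\<close> a multiple of \<open>n * m\<close>. Cancelling \<open>n * m\<close>
    then shows that \<open>m\<close> is a scalar.\<close>
  define X where "X = m * n - n * m"
  have "m * (n - m) - (n - m) * m = (\<i> * t) *\<^sub>C (m * (n * m) - n * m * m)"
    by (simp only: nm mult_scaleC_left mult_scaleC_right scaleC_diff_right)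
  moreover have "m * (n - m) - (n - m) * m = X" "m * (n * m) - n * m * m = X * m"
    by (simp_all add: X_def right_diff_distrib left_diff_distrib mult.assoc)
  ultimately have "X = (\<i> * t) *\<^sub>C (X * m)"
    by simp
  then have "s *\<^sub>C X = s *\<^sub>C (\<i> * t) *\<^sub>C (X * m)"
    by (rule arg_cong)
  also have "\<dots> = (\<i> * t) *\<^sub>C (s *\<^sub>C X * m)"
    by (simp only: mult_scaleC_left scaleC_scaleC mult.commute)
  finally have "s *\<^sub>C X = (\<i> * t) *\<^sub>C (s *\<^sub>C X * m)" .
  moreover have "s *\<^sub>C X = - ((s + t) *\<^sub>C (n * m))"
    by (simp add: X_def scaleC_diff_right sum scaleC_add_left)
  ultimately have "(s + t) *\<^sub>C (n * m - (\<i> * t) *\<^sub>C (n * m * m)) = 0"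
    by (simp add: mult_scaleC_left scaleC_diff_right scaleC_scaleC scaleC_minus_right mult.commute)
  with st have "n * m * (1 - (\<i> * t) *\<^sub>C m) = 0"
    by (simp add: right_diff_distrib mult_scaleC_right)
  then have one: "1 = (\<i> * t) *\<^sub>C m" using cancel by fastforce
  have "(\<i> * t) *\<^sub>C (n * m) = n * ((\<i> * t) *\<^sub>C m)" "(\<i> * t) *\<^sub>C (m * n) = ((\<i> * t) *\<^sub>C m) * n"
    by (simp_all add: mult_scaleC_left mult_scaleC_right)
  then have "(\<i> * t) *\<^sub>C (m * n - n * m) = 0"
    by (simp add: scaleC_diff_right flip: one)
  moreover have "t \<noteq> 0" using one by auto
  ultimately have "m * n = n * m" by simp
  with sum have "(s + t) *\<^sub>C (n * m) = 0" by (simp add: scaleC_add_left)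
  with st have "n * m * 1 = 0" by simp
  then show False using cancel[of 1] by simp
qed

section \<open>Linear relations among regular directions\<close>

text \<open>A common right multiple of the resolvents: formally, its range lies in the domain of each of
  the generators \<open>(R 1 g)\<^sup>-\<^sup>1\<close>.\<close>

lemma common_multiple:
  assumes "finite T" "\<And>g. g \<in> T \<Longrightarrow> regular g"
  shows "\<exists>B\<in>A0. (\<forall>b. B * b = 0 \<longrightarrow> b = 0) \<and> (\<forall>g\<in>T. \<exists>w\<in>A0. B = R 1 g * w)"
  using assms
proof (induction T)
  case empty
  show ?case by (intro bexI[of _ 1]) (auto simp: A0_1)
next
  case (insert h T)
  then obtain B where B: "B \<in> A0" "\<And>b. B * b = 0 \<Longrightarrow> b = 0"
    "\<And>g. g \<in> T \<Longrightarrow> \<exists>w\<in>A0. B = R 1 g * w"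
    by auto
  have h: "regular h" and Rh: "R 1 h \<in> A0" using insert by (auto simp: R_A0)
  \<comment> \<open>Moving \<open>R 1 g\<close> to the left past \<open>R 1 h\<close> leaves a
    cofactor that still lies in \<open>A0\<close>.\<close>
  have "\<exists>w\<in>A0. R 1 h * B = R 1 g * w" if g: "g \<in> T" for g
  proof -
    obtain w where w: "w \<in> A0" "B = R 1 g * w" using B(3)[OF g] by blast
    have "R 1 h * B = R 1 g * (R 1 h * w - \<i> *\<^sub>C (\<delta> g (R 1 h) * B))"
      using mult_R[of 1 "R 1 h" g] Rh
      by (simp add: w(2) left_diff_distrib right_diff_distrib mult_scaleC_left mult_scaleC_right
          flip: mult.assoc)
    moreover have "R 1 h * w - \<i> *\<^sub>C (\<delta> g (R 1 h) * B) \<in> A0"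
      by (intro A0_diff A0_mult A0_scaleC deriv_A0 Rh B w)
    ultimately show ?thesis by blast
  qed
  moreover have "b = 0" if "R 1 h * B * b = 0" for b
    using that B(2) R_cancel_left[OF h, of 1 "B * b"] by (simp add: mult.assoc)
  ultimately show ?case
    using B(1) Rh by (intro bexI[of _ "R 1 h * B"]) (auto intro: A0_mult)
qed

text \<open>With \<open>Q\<close> the formal inverse of \<open>R 1 g\<close>, so that \<open>w = Q B\<close> and \<open>z = Q u\<close>, this is the commutation
  relation \<open>Q (B a) u = B a Q u - \<i> \<delta> g (B a) u\<close>.\<close>

lemma generator_commutation:
  assumes g: "regular g" and A0: "B \<in> A0" "a \<in> A0" and B: "B = R 1 g * w" and u: "u = R 1 g * z"
  shows "w * a * u = B * a * z - \<i> *\<^sub>C (\<delta> g (B * a) * u)"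
proof (rule R_eq_cancel_left[OF g one_neq_zero])
  define p where "p = B * a"
  have "p \<in> A0" using A0 by (simp add: p_def A0_mult)
  have "p * u = p * R 1 g * z"
    by (simp add: u mult.assoc)
  also have "\<dots> = R 1 g * (p * z - \<i> *\<^sub>C (\<delta> g p * u))"
    using \<open>p \<in> A0\<close> by (simp add: mult_R u right_diff_distrib left_diff_distrib mult_scaleC_left
        mult_scaleC_right mult.assoc)
  finally show "R 1 g * (w * a * u) = R 1 g * (B * a * z - \<i> *\<^sub>C (\<delta> g (B * a) * u))"
    by (simp add: p_def B mult.assoc)
qed

lemma sum_deriv_eq_0:
  assumes "(\<Sum>g\<in>T. c g *\<^sub>R g) = 0" "a \<in> A0"
  shows "(\<Sum>g\<in>T. c g *\<^sub>R \<delta> g a) = 0"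
  using assms linear_sum[OF linear_action, of a "\<lambda>g. c g *\<^sub>R g" T]
    linear_scale[OF linear_action, of a] by (simp add: deriv_zero_left)

text \<open>If \<open>\<Sum> c g g = 0\<close>, then the combination \<open>\<Sum> c g Q g\<close> of the generators \<open>Q g = (R 1 g)\<^sup>-\<^sup>1\<close> commutes
  with \<open>A0\<close>, so it is a scalar \<open>k\<close>; applying \<open>\<delta> f\<close> to it gives \<open>\<Sum> c g \<sigma>(f, g) = 0\<close>.\<close>

lemma sigma_dependent:
  assumes fin: "finite T" and reg: "\<And>g. g \<in> T \<Longrightarrow> regular g"
    and dep: "(\<Sum>g\<in>T. c g *\<^sub>R g) = 0"
  shows "(\<Sum>g\<in>T. c g * sigma f g) = 0"
proof -
  obtain B where B: "B \<in> A0" "\<And>b. B * b = 0 \<Longrightarrow> b = 0"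
    and "\<forall>g\<in>T. \<exists>w\<in>A0. B = R 1 g * w"
    using common_multiple[OF fin reg] by blast
  then obtain w where w: "\<And>g. g \<in> T \<Longrightarrow> w g \<in> A0" "\<And>g. g \<in> T \<Longrightarrow> B = R 1 g * w g"
    by metis
  \<comment> \<open>Formally the combination of generators applied to \<open>B\<close>.\<close>
  define E where "E = (\<Sum>g\<in>T. c g *\<^sub>R w g)"
  \<comment> \<open>Summing \<open>generator_commutation\<close> over \<open>T\<close>, the
    derivation terms add up to zero by the linear dependence.\<close>
  have E: "E * a * u = B * a * (\<Sum>g\<in>T. c g *\<^sub>R z g)"
    if "a \<in> A0" and u: "\<And>g. g \<in> T \<Longrightarrow> u = R 1 g * z g" for a u z
  proof -
    have "E * a * u = (\<Sum>g\<in>T. c g *\<^sub>R (w g * a * u))"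
      by (simp add: E_def sum_distrib_right)
    also have "\<dots> = (\<Sum>g\<in>T. B * a * (c g *\<^sub>R z g) - \<i> *\<^sub>C (c g *\<^sub>R \<delta> g (B * a) * u))"
      by (rule sum.cong)
         (simp_all add: generator_commutation[OF reg B(1) \<open>a \<in> A0\<close> w(2) u] scaleR_diff_right
            scaleC_scaleR)
    also have "\<dots> = B * a * (\<Sum>g\<in>T. c g *\<^sub>R z g) - \<i> *\<^sub>C ((\<Sum>g\<in>T. c g *\<^sub>R \<delta> g (B * a)) * u)"
      by (simp add: sum_subtractf sum_distrib_left sum_distrib_right scaleC_sum_right)
    also have "(\<Sum>g\<in>T. c g *\<^sub>R \<delta> g (B * a)) = 0"
      using dep that(1) B(1) by (intro sum_deriv_eq_0 A0_mult)
    finally show ?thesis by simp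
  qed
  have B_nonzero: "B \<noteq> 0" using B(2)[of 1] by auto
  have "E * x * B = B * x * E" for x
  proof (rule A0_dense_eq[where p = "\<lambda>x. E * x * B" and q = "\<lambda>x. B * x * E"])
    show "E * a * B = B * a * E" if "a \<in> A0" for a
      using E[OF that w(2)] by (simp add: E_def)
  qed (intro continuous_intros)+
  then obtain k where k: "E = k *\<^sub>C B"
    using primitive_exchange_imp_proportional[OF primitive_TYPE _ B_nonzero] by blast
  \<comment> \<open>Formally the generator of \<open>g\<close> applied to
    \<open>\<delta> f B\<close>, read off from the product rule for
    \<open>B = R 1 g * w g\<close>.\<close>
  define z where "z g = sigma f g *\<^sub>R B + \<delta> f (w g)" for g
  have "\<delta> f B = R 1 g * z g" if g: "g \<in> T" for g
  proof -
    have "\<delta> f B = \<delta> f (R 1 g * w g)" using w(2)[OF g] by simp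
    also have "\<dots> = sigma f g *\<^sub>R (R 1 g)\<^sup>2 * w g + R 1 g * \<delta> f (w g)"
      using w(1)[OF g] reg[OF g] by (simp add: deriv_mult R_A0 deriv_R)
    also have "(R 1 g)\<^sup>2 * w g = R 1 g * B"
      using w(2)[OF g] by (simp add: power2_eq_square mult.assoc)
    then have "sigma f g *\<^sub>R (R 1 g)\<^sup>2 * w g = R 1 g * (sigma f g *\<^sub>R B)"
      by simp
    finally show ?thesis by (simp add: z_def distrib_left)
  qed
  \<comment> \<open>The sum of the \<open>c g *\<^sub>R z g\<close> is thus
    \<open>k *\<^sub>C \<delta> f B\<close>, which differentiating \<open>E = k *\<^sub>C B\<close>
    evaluates without any \<open>sigma\<close>. The difference is the wanted sum times
    \<open>B\<close>.\<close>
  then have "E * 1 * \<delta> f B = B * 1 * (\<Sum>g\<in>T. c g *\<^sub>R z g)"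
    by (rule E[OF A0_1])
  then have "B * (k *\<^sub>C \<delta> f B - (\<Sum>g\<in>T. c g *\<^sub>R z g)) = 0"
    by (simp add: k right_diff_distrib mult_scaleC_left mult_scaleC_right)
  then have "(\<Sum>g\<in>T. c g *\<^sub>R z g) = k *\<^sub>C \<delta> f B"
    using B(2) by fastforce
  moreover have "k *\<^sub>C \<delta> f B = (\<Sum>g\<in>T. c g *\<^sub>R \<delta> f (w g))"
  proof -
    have "\<delta> f (c g *\<^sub>R w g) = c g *\<^sub>R \<delta> f (w g)" if "g \<in> T" for g
      using deriv_scaleC[OF w(1)[OF that], of f "of_real (c g)"] by (simp add: scaleC_of_real)
    then have "\<delta> f E = (\<Sum>g\<in>T. c g *\<^sub>R \<delta> f (w g))"
      unfolding E_def using w(1) by (subst deriv_sum) (auto intro: A0_scaleR)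
    then show ?thesis using B(1) by (simp add: k deriv_scaleC)
  qed
  moreover have "(\<Sum>g\<in>T. c g *\<^sub>R z g) = (\<Sum>g\<in>T. c g * sigma f g) *\<^sub>R B + (\<Sum>g\<in>T. c g *\<^sub>R \<delta> f (w g))"
    by (simp add: z_def scaleR_add_right sum.distrib scaleR_sum_left)
  ultimately show ?thesis
    using B_nonzero by simp
qed

end

section \<open>Extension to the whole space\<close>

text \<open>Extend linearly from the basis twice: \<open>L\<close> in the first argument, then
  \<open>M\<close> in the second.\<close>

lemma bilinear_extension:
  fixes \<beta> :: "'x::real_vector \<Rightarrow> 'x \<Rightarrow> real"
  assumes indep: "independent S" and spans: "span S = UNIV"
  shows "\<exists>\<sigma>. bilinear \<sigma> \<and> (\<forall>b\<in>S. \<forall>b'\<in>S. \<sigma> b b' = \<beta> b b')"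
proof -
  have ext: "\<exists>h. linear h \<and> (\<forall>b\<in>S. h b = \<phi> b)" for \<phi> :: "'x \<Rightarrow> real"
    using indep by (rule linear_independent_extend)
  obtain L where L: "\<And>b'. linear (L b')" "\<And>b b'. b \<in> S \<Longrightarrow> L b' b = \<beta> b b'"
    using ext[of "\<lambda>b. \<beta> b b'" for b'] by metis
  obtain M where M: "\<And>x. linear (M x)" "\<And>x b'. b' \<in> S \<Longrightarrow> M x b' = L b' x"
    using ext[of "\<lambda>b'. L b' x" for x] by metis
  have eq: "h y = k y" if "linear h" "linear k" "\<And>b. b \<in> S \<Longrightarrow> h b = k b"
    for h k :: "'x \<Rightarrow> real" and y
    using linear_eq_on[of h k y S] that spans by auto
  have "linear (\<lambda>x. M x y)" for y
  proof (rule linearI)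
    show "M (x + x') y = M x y + M x' y" for x x'
      by (rule eq[OF M(1) linear_compose_add[OF M(1) M(1)]]) (simp add: M(2) linear_add[OF L(1)])
    show "M (r *\<^sub>R x) y = r *\<^sub>R M x y" for r x
      by (rule eq[OF M(1) linear_compose_scale_right[OF M(1)]])
        (simp add: M(2) linear_scale[OF L(1)])
  qed
  then have "bilinear M" using M(1) by (simp add: bilinear_def)
  moreover have "M b b' = \<beta> b b'" if "b \<in> S" "b' \<in> S" for b b'
    using that by (simp add: M(2) L(2))
  ultimately show ?thesis by blast
qed

lemma (in flat_lie_cstar_system) sigma_extension:
  obtains \<sigma> where "bilinear \<sigma>" "antisymmetric \<sigma>" "\<And>f g. regular g \<Longrightarrow> \<sigma> f g = sigma f g"
proof -
  obtain S1 where S1: "S1 \<subseteq> {g. regular g}" "independent S1" "{g. regular g} \<subseteq> span S1"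
    by (rule maximal_independent_subset)
  obtain S where S: "S1 \<subseteq> S" "independent S" and "UNIV \<subseteq> span S"
    by (rule maximal_independent_subset_extend[OF subset_UNIV S1(2)])
  then have span_S: "span S = UNIV" by blast
  \<comment> \<open>\<open>S1\<close> is a basis of the span of the regular vectors and consists of
    regular vectors. The second branch is dictated by antisymmetry; pairs outside \<open>S1\<close>
    are unconstrained and get 0.\<close>
  define \<beta> where "\<beta> b b' = (if b' \<in> S1 then sigma b b' else if b \<in> S1 then - sigma b' b else 0)" for b b'
  have \<beta>: "\<beta> b b' = - \<beta> b' b" for b b'
    using S1(1) sigma_antisymmetric[of b b'] by (auto simp: \<beta>_def)
  obtain \<sigma> where \<sigma>: "bilinear \<sigma>" and on_S: "\<And>b b'. b \<in> S \<Longrightarrow> b' \<in> S \<Longrightarrow> \<sigma> b b' = \<beta> b b'"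
    using bilinear_extension[OF S(2) span_S, of \<beta>] by blast
  have lin: "linear (\<lambda>x. \<sigma> x y)" "linear (\<sigma> y)" for y
    using \<sigma> by (auto simp: bilinear_def)
  have eq: "h y = k y" if "linear h" "linear k" "\<And>b. b \<in> S \<Longrightarrow> h b = k b"
    for h k :: "'x \<Rightarrow> real" and y
    using linear_eq_on[of h k y S] that span_S by auto
  have anti_S: "\<sigma> x b = - \<sigma> b x" if b: "b \<in> S" for b x
  proof (rule eq[OF lin(1)[of b] linear_compose_neg[OF lin(2)[of b]]])
    show "\<sigma> b' b = - \<sigma> b b'" if "b' \<in> S" for b'
      unfolding on_S[OF that b] on_S[OF b that] by (rule \<beta>)
  qed
  have "\<sigma> x y = - \<sigma> y x" for x y
    using eq[OF lin(2)[of x] linear_compose_neg[OF lin(1)[of x]], of y] anti_S by blast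
  then have "antisymmetric \<sigma>" unfolding antisymmetric_def by blast
  moreover have "\<sigma> f g = sigma f g" if g: "regular g" for f g
  proof (rule eq[OF lin(1)[of g] linear_sigma_left[OF g]])
    fix b assume b: "b \<in> S"
    show "\<sigma> b g = sigma b g"
    proof (cases "g \<in> S1")
      case True
      then show ?thesis using b S(1) by (auto simp: on_S \<beta>_def)
    next
      case False
      have "g \<in> span S1" using S1(3) g by blast
      then obtain T c where T: "finite T" "T \<subseteq> S1" "g = (\<Sum>a\<in>T. c a *\<^sub>R a)"
        unfolding span_explicit by blast
      with False have "g \<notin> T" by blast
      \<comment> \<open>The coefficient -1 at \<open>g\<close> turns the expansion of
        \<open>g\<close> into a linear relation among regular vectors, to which
        \<open>sigma_dependent\<close> applies.\<close>
      define d where "d = c(g := - 1)"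
      have d: "d g = - 1" "\<And>a. a \<in> T \<Longrightarrow> d a = c a"
        using \<open>g \<notin> T\<close> by (auto simp: d_def)
      have "(\<Sum>a\<in>insert g T. d a * sigma b a) = 0"
      proof (rule sigma_dependent)
        show "(\<Sum>a\<in>insert g T. d a *\<^sub>R a) = 0"
          using T(1) \<open>g \<notin> T\<close> by (simp add: d flip: T(3))
      qed (use T S1(1) g in auto)
      then have "sigma b g = (\<Sum>a\<in>T. c a * sigma b a)"
        using T(1) \<open>g \<notin> T\<close> by (simp add: d)
      also have "\<dots> = (\<Sum>a\<in>T. c a * \<sigma> b a)"
        using T(2) S(1) b by (intro sum.cong) (auto simp: on_S \<beta>_def subset_iff)
      also have "\<dots> = \<sigma> b g"
        by (simp add: T(3) linear_sum[OF lin(2)] linear_scale[OF lin(2)])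
      finally show ?thesis by simp
    qed
  qed
  ultimately show ?thesis using \<sigma> that by blast
qed

section \<open>The commutation relations and non-degeneracy\<close>

theorem proposition2p7:
  fixes A0 :: "'a::cstar_algebra set"
    and \<delta> :: "'x::real_vector \<Rightarrow> 'a \<Rightarrow> 'a"
    and R :: "real \<Rightarrow> 'x \<Rightarrow> 'a"
  assumes "flat_lie_cstar_system TYPE('h::chilbert_space) A0 \<delta> R"
  shows "\<exists>\<sigma> :: 'x \<Rightarrow> 'x \<Rightarrow> real.
    bilinear \<sigma> \<and> antisymmetric \<sigma> \<and>
    (\<forall>\<kappa> \<mu> f g. \<kappa> \<noteq> 0 \<and> \<mu> \<noteq> 0 \<longrightarrow>
       commutator (R \<kappa> f) (R \<mu> g)
         = (\<i> * of_real (\<sigma> f g)) *\<^sub>C (R \<kappa> f * (R \<mu> g)\<^sup>2 * R \<kappa> f)) \<and>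
    (\<forall>\<mu> f g. \<mu> \<noteq> 0 \<longrightarrow> \<delta> f (R \<mu> g) = \<sigma> f g *\<^sub>R (R \<mu> g)\<^sup>2) \<and>
    (ergodic_action A0 \<delta> \<and> nonzero_resolvents R \<longrightarrow> nondegenerate \<sigma>)"
proof -
  interpret flat_lie_cstar_system "TYPE('h)" A0 \<delta> R by fact
  obtain \<sigma> where \<sigma>: "bilinear \<sigma>" "antisymmetric \<sigma>" "\<And>f g. regular g \<Longrightarrow> \<sigma> f g = sigma f g"
    using sigma_extension by blast
  have comm: "commutator (R \<kappa> f) (R \<mu> g)
      = (\<i> * of_real (\<sigma> f g)) *\<^sub>C (R \<kappa> f * (R \<mu> g)\<^sup>2 * R \<kappa> f)" if "\<kappa> \<noteq> 0" "\<mu> \<noteq> 0" for \<kappa> \<mu> f g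
  proof (cases "regular f \<and> regular g")
    case True
    then show ?thesis using commutator_R that \<sigma>(3) by simp
  next
    case False
    then have "R \<kappa> f = 0 \<or> R \<mu> g = 0" using regular_iff that by blast
    then show ?thesis by (auto simp: commutator_def)
  qed
  have deriv: "\<delta> f (R \<mu> g) = \<sigma> f g *\<^sub>R (R \<mu> g)\<^sup>2" if "\<mu> \<noteq> 0" for \<mu> f g
    using deriv_R[of g \<mu> f] \<sigma>(3)[of g f] regular_iff[OF that, of g] that
    by (cases "regular g") (auto simp: deriv_0)
  have "f = 0" if erg: "ergodic_action A0 \<delta>" and nz: "nonzero_resolvents R"
    and null: "\<And>g. \<sigma> f g = 0" for f
  proof (rule ccontr)
    assume "f \<noteq> 0"
    then have f: "regular f" using nz regular_iff unfolding nonzero_resolvents_def by blast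
    \<comment> \<open>A null direction makes every derivation kill \<open>R 1 f\<close>, so
      ergodicity turns \<open>R 1 f\<close> into a scalar.\<close>
    have "\<sigma> g f = 0" for g using null \<sigma>(2) unfolding antisymmetric_def by (metis neg_0_equal_iff_equal)
    then have "\<delta> g (R 1 f) = 0" for g by (simp add: deriv)
    then obtain c where c: "R 1 f = c *\<^sub>C 1"
      using erg R_A0[of 1 f] unfolding ergodic_action_def by auto
    have "c \<noteq> 0" using f c by (auto simp: regular_def)
    \<comment> \<open>A nonzero scalar commutes with \<open>a\<close>, so
      \<open>resolvent_derivation\<close> forces \<open>\<delta> f a\<close> to vanish; injectivity
      of the action then contradicts \<open>f \<noteq> 0\<close>.\<close>
    have "\<delta> f a = 0" if "a \<in> A0" for a
      using resolvent_derivation[OF _ that, of 1 f] \<open>c \<noteq> 0\<close>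
      by (simp add: c commutator_def mult_scaleC_left mult_scaleC_right)
    then have "f = 0" by (intro injective_action) (simp add: deriv_zero_left)
    with \<open>f \<noteq> 0\<close> show False by simp
  qed
  with \<sigma>(1,2) comm deriv show ?thesis
    unfolding nondegenerate_def by blast
qed

end
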